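(* Let $p=0.05$, $q=0.4$, let $\mathcal N_1$ be the qubit dephasing channel $\mathcal N_1(\rho)=q\rho+(1-q)\sigma_z\rho\sigma_z$ and $\mathcal N_2$ the qubit depolarizing channel $\mathcal N_2(\rho)=(1-p)\rho+p\,(\operatorname{Tr}\rho)\,I/2$, and consider the AB algorithm for the unconstrained problem of minimizing $f(\rho)=-D(\sqrt{\rho}\,\Gamma^{\mathcal N_1}\sqrt{\rho}\,\|\,\sqrt{\rho}\,\Gamma^{\mathcal N_2}\sqrt{\rho})=\operatorname{Tr}[\rho\,\Omega(\rho)]$ over all qubit density operators. Then the maximally mixed state $I/2$ is the unique full-rank fixed point of the AB algorithm, i.e. the unique positive-definite qubit state $\rho$ with $\mathcal T_{AB}(\rho)=\rho$.
   Context: $\mathcal H_A=\mathcal H_B=\mathbb C^2$; $\sigma_z$ is the Pauli $Z$ matrix; $\log$ is the natural logarithm. For a channel $\mathcal N$ from $A$ to $B$, the (unnormalized) Choi matrix is $\Gamma^{\mathcal N}=\sum_{i,j}|i\rangle\langle j|_A\otimes\mathcal N(|i\rangle\langle j|)_B$. $D(\sigma\|\tau)=\operatorname{Tr}\,\sigma(\log\sigma-\log\tau)$. For a positive-definite state $\rho$ on $A$, powers of $\rho$ are understood as acting as $\rho^{s}\otimes I_B$, and $$\Omega_1(\rho)=-\operatorname{Tr}_B\!\big(\Gamma^{\mathcal N_1}\rho^{1/2}\big(\log(\rho^{1/2}\Gamma^{\mathcal N_1}\rho^{1/2})-\log(\rho^{1/2}\Gamma^{\mathcal N_2}\rho^{1/2})\big)\rho^{-1/2}\big),\qquad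 \Omega(\rho)=\tfrac12(\Omega_1(\rho)+\Omega_1(\rho)^\dagger),$$ where the logarithm of the singular operator $\rho^{1/2}\Gamma^{\mathcal N_1}\rho^{1/2}$ is taken on its support (and is $0$ on its kernel). With a fixed $\gamma>0$, the Arimoto–Blahut (AB) map (no linear constraints besides normalization) is $\mathcal T_{AB}(\rho)=\exp(\log\rho-\tfrac1\gamma\Omega(\rho))/\operatorname{Tr}\exp(\log\rho-\tfrac1\gamma\Omega(\rho))$ for positive-definite states $\rho$. *)

theory Defs
  imports "HOL-Analysis.Analysis"
begin

text \<open>
  Operators on a finite-dimensional Hilbert space with an orthonormal basis indexed by \<open>'n\<close> are
  matrices \<open>complex^'n^'n\<close>.  A qubit has the index type \<open>2\<close>, where the index \<open>1\<close> stands for the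
  basis vector \<open>|0>\<close> and \<open>2\<close> for \<open>|1>\<close>.  The product space \<open>A \<otimes> B\<close> has the index type \<open>'a \<times> 'b\<close>.
\<close>

definition conj_transpose :: "complex^'n^'m \<Rightarrow> complex^'m^'n"
  where "conj_transpose A = (\<chi> i j. cnj (A $ j $ i))"

definition hermitian :: "complex^'n^'n \<Rightarrow> bool"
  where "hermitian A \<longleftrightarrow> conj_transpose A = A"

definition unitary :: "complex^'n^'n \<Rightarrow> bool"
  where "unitary U \<longleftrightarrow> conj_transpose U ** U = mat 1 \<and> U ** conj_transpose U = mat 1"

text \<open>The value \<open>\<langle>x|A|x\<rangle>\<close>, which is real for Hermitian \<open>A\<close>.\<close>

definition quadratic_form :: "complex^'n^'n \<Rightarrow> complex^'n \<Rightarrow> real"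
  where "quadratic_form A x = Re (\<Sum>i\<in>UNIV. cnj (x $ i) * (A *v x) $ i)"

definition positive_semidefinite :: "complex^'n^'n \<Rightarrow> bool"
  where "positive_semidefinite A \<longleftrightarrow> hermitian A \<and> (\<forall>x. 0 \<le> quadratic_form A x)"

definition positive_definite :: "complex^'n^'n \<Rightarrow> bool"
  where "positive_definite A \<longleftrightarrow> hermitian A \<and> (\<forall>x. x \<noteq> 0 \<longrightarrow> 0 < quadratic_form A x)"

definition density_operator :: "complex^'n^'n \<Rightarrow> bool"
  where "density_operator A \<longleftrightarrow> positive_semidefinite A \<and> trace A = 1"


definition real_diag :: "('n \<Rightarrow> real) \<Rightarrow> complex^'n^'n"
  where "real_diag d = (\<chi> i j. if i = j then complex_of_real (d i) else 0)"

text \<open>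
  Functional calculus for Hermitian matrices: \<open>f(A) = U diag(f(d)) U\<^sup>\<dagger>\<close> for any unitary
  diagonalization \<open>A = U diag(d) U\<^sup>\<dagger>\<close>.  The result does not depend on the diagonalization
  (lemma \<open>herm_fun_eqI\<close>), and one exists for every Hermitian \<open>A\<close> by the spectral theorem.
\<close>

definition herm_fun :: "(real \<Rightarrow> real) \<Rightarrow> complex^'n^'n \<Rightarrow> complex^'n^'n"
  where "herm_fun f A = (THE B. \<exists>U d. unitary U \<and>
           A = U ** real_diag d ** conj_transpose U \<and>
           B = U ** real_diag (f \<circ> d) ** conj_transpose U)"

lemma real_diag_mult_nth:
  "(real_diag d ** W) $ i $ j = complex_of_real (d i) * W $ i $ j"
  "(W ** real_diag d) $ i $ j = W $ i $ j * complex_of_real (d j)"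
  by (simp_all add: matrix_matrix_mult_def real_diag_def if_distrib [of "\<lambda>x. x * _"]
        if_distrib [of "\<lambda>x. _ * x"] cong: if_cong)

lemma herm_fun_eqI:
  assumes U: "unitary U" and A: "A = U ** real_diag d ** conj_transpose U"
  shows "herm_fun f A = U ** real_diag (f \<circ> d) ** conj_transpose U"
  unfolding herm_fun_def
proof (rule the_equality)
  show "\<exists>U' d'. unitary U' \<and> A = U' ** real_diag d' ** conj_transpose U' \<and>
          U ** real_diag (f \<circ> d) ** conj_transpose U =
          U' ** real_diag (f \<circ> d') ** conj_transpose U'"
    using assms by blast
next
  fix B
  assume "\<exists>V e. unitary V \<and> A = V ** real_diag e ** conj_transpose V \<and>
            B = V ** real_diag (f \<circ> e) ** conj_transpose V"
  then obtain V e where V: "unitary V" and AV: "A = V ** real_diag e ** conj_transpose V"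
    and B: "B = V ** real_diag (f \<circ> e) ** conj_transpose V"
    by blast
  let ?U' = "conj_transpose U" and ?V' = "conj_transpose V"
  define W where "W = ?V' ** U"
  have UU: "?U' ** U = mat 1" "U ** ?U' = mat 1" and VV: "?V' ** V = mat 1" "V ** ?V' = mat 1"
    using U V by (auto simp: unitary_def)
  have "real_diag e ** W = ?V' ** A ** U"
    by (simp add: W_def AV matrix_mul_assoc VV)
  also have "\<dots> = W ** real_diag d"
    by (simp add: W_def A matrix_mul_assoc [symmetric] UU)
  finally have comm: "complex_of_real (e i) * W $ i $ j = W $ i $ j * complex_of_real (d j)" for i j
    by (metis real_diag_mult_nth)
  have "complex_of_real (f (e i)) * W $ i $ j = W $ i $ j * complex_of_real (f (d j))" for i j
    using comm [of i j] by (cases "W $ i $ j = 0") auto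
  then have "real_diag (f \<circ> e) ** W = W ** real_diag (f \<circ> d)"
    by (simp add: vec_eq_iff real_diag_mult_nth)
  then have "V ** (real_diag (f \<circ> e) ** W) ** ?U' = V ** (W ** real_diag (f \<circ> d)) ** ?U'"
    by simp
  moreover have "V ** (real_diag (f \<circ> e) ** W) ** ?U' = B"
    by (simp add: B W_def matrix_mul_assoc [symmetric] UU)
  moreover have "V ** (W ** real_diag (f \<circ> d)) ** ?U' = U ** real_diag (f \<circ> d) ** ?U'"
    by (simp add: W_def matrix_mul_assoc VV)
  ultimately show "B = U ** real_diag (f \<circ> d) ** ?U'"
    by simp
qed

text \<open>The logarithm of a positive semidefinite matrix is taken on its support.\<close>

definition mlog :: "complex^'n^'n \<Rightarrow> complex^'n^'n"
  where "mlog = herm_fun (\<lambda>x. if 0 < x then ln x else 0)"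

definition mexp :: "complex^'n^'n \<Rightarrow> complex^'n^'n"
  where "mexp = herm_fun exp"

definition mpowr :: "complex^'n^'n \<Rightarrow> real \<Rightarrow> complex^'n^'n"
  where "mpowr A s = herm_fun (\<lambda>x. x powr s) A"


definition tensor :: "complex^'a^'a \<Rightarrow> complex^'b^'b \<Rightarrow> complex^('a \<times> 'b)^('a \<times> 'b)"
  where "tensor X Y = (\<chi> r c. X $ fst r $ fst c * Y $ snd r $ snd c)"

text \<open>The partial trace over the second factor.\<close>

definition ptrace_B :: "complex^('a \<times> 'b::finite)^('a \<times> 'b) \<Rightarrow> complex^'a^'a"
  where "ptrace_B X = (\<chi> i j. \<Sum>b\<in>UNIV. X $ (i, b) $ (j, b))"

definition matrix_unit :: "'n \<Rightarrow> 'n \<Rightarrow> complex^'n^'n"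
  where "matrix_unit i j = (\<chi> k l. if k = i \<and> l = j then 1 else 0)"

definition choi :: "(complex^'a^'a \<Rightarrow> complex^'b^'b) \<Rightarrow> complex^('a \<times> 'b)^('a \<times> 'b)"
  where "choi N = (\<Sum>i\<in>UNIV. \<Sum>j\<in>UNIV. tensor (matrix_unit i j) (N (matrix_unit i j)))"

text \<open>The powers \<open>\<rho>\<^sup>s\<close> of an operator on \<open>A\<close>, acting on \<open>A \<otimes> B\<close> as \<open>\<rho>\<^sup>s \<otimes> I\<close>.\<close>

definition powr_A :: "complex^'a^'a \<Rightarrow> real \<Rightarrow> complex^('a \<times> 'b::finite)^('a \<times> 'b)"
  where "powr_A \<rho> s = tensor (mpowr \<rho> s) (mat 1)"

definition sandwich :: "(complex^'a^'a \<Rightarrow> complex^'b^'b) \<Rightarrow> complex^'a^'a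
    \<Rightarrow> complex^('a \<times> 'b)^('a \<times> 'b)"
  where "sandwich N \<rho> = powr_A \<rho> (1/2) ** choi N ** powr_A \<rho> (1/2)"


text \<open>
  \<open>D(\<sigma>\<parallel>\<tau>) = Tr \<sigma> (log \<sigma> - log \<tau>)\<close>, for positive semidefinite arguments with the support of \<open>\<sigma>\<close>
  contained in that of \<open>\<tau>\<close>; the trace is then real.
\<close>

definition rel_entropy :: "complex^'n^'n \<Rightarrow> complex^'n^'n \<Rightarrow> real"
  where "rel_entropy \<sigma> \<tau> = Re (trace (\<sigma> ** (mlog \<sigma> - mlog \<tau>)))"

definition objective :: "(complex^'a^'a \<Rightarrow> complex^'b^'b) \<Rightarrow> (complex^'a^'a \<Rightarrow> complex^'b^'b)
    \<Rightarrow> complex^'a^'a \<Rightarrow> real"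
  where "objective N1 N2 \<rho> = - rel_entropy (sandwich N1 \<rho>) (sandwich N2 \<rho>)"

definition Omega1 :: "(complex^'a^'a \<Rightarrow> complex^'b^'b) \<Rightarrow> (complex^'a^'a \<Rightarrow> complex^'b^'b)
    \<Rightarrow> complex^'a^'a \<Rightarrow> complex^'a^'a"
  where "Omega1 N1 N2 \<rho> =
    - ptrace_B (choi N1 ** powr_A \<rho> (1/2)
                  ** (mlog (sandwich N1 \<rho>) - mlog (sandwich N2 \<rho>))
                  ** powr_A \<rho> (-1/2))"

definition Omega :: "(complex^'a^'a \<Rightarrow> complex^'b^'b) \<Rightarrow> (complex^'a^'a \<Rightarrow> complex^'b^'b)
    \<Rightarrow> complex^'a^'a \<Rightarrow> complex^'a^'a"
  where "Omega N1 N2 \<rho> = (1/2) *\<^sub>R (Omega1 N1 N2 \<rho> + conj_transpose (Omega1 N1 N2 \<rho>))"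

definition normalize_trace :: "complex^'n^'n \<Rightarrow> complex^'n^'n"
  where "normalize_trace X = (\<chi> i j. X $ i $ j / trace X)"

definition AB_map :: "real \<Rightarrow> (complex^'a^'a \<Rightarrow> complex^'b^'b)
    \<Rightarrow> (complex^'a^'a \<Rightarrow> complex^'b^'b) \<Rightarrow> complex^'a^'a \<Rightarrow> complex^'a^'a"
  where "AB_map \<gamma> N1 N2 \<rho> = normalize_trace (mexp (mlog \<rho> - (1/\<gamma>) *\<^sub>R Omega N1 N2 \<rho>))"


definition pauli_Z :: "complex^2^2"
  where "pauli_Z = vector [vector [1, 0], vector [0, -1]]"

definition dephasing :: "real \<Rightarrow> complex^2^2 \<Rightarrow> complex^2^2"
  where "dephasing q \<rho> = q *\<^sub>R \<rho> + (1 - q) *\<^sub>R (pauli_Z ** \<rho> ** pauli_Z)"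

text \<open>The term \<open>mat (trace \<rho>)\<close> is \<open>(Tr \<rho>) I\<close>.\<close>

definition depolarizing :: "real \<Rightarrow> complex^2^2 \<Rightarrow> complex^2^2"
  where "depolarizing p \<rho> = (1 - p) *\<^sub>R \<rho> + p *\<^sub>R ((1/2) *\<^sub>R mat (trace \<rho>))"

end

theory Submission
  imports Defs
begin

text \<open>
  A positive definite state \<open>\<rho>\<close> is fixed by the AB map iff \<open>\<Omega>(\<rho>)\<close> is a multiple of \<open>I\<close>, so that then
  \<open>Tr ((\<rho> - I/2) \<Omega>(\<rho>)) = 0\<close>.  This trace is explicit.  In an eigenbasis of \<open>\<rho>\<close> on \<open>A\<close>, and the
  conjugate one on \<open>B\<close>, the operator \<open>\<rho>\<^sup>1\<^sup>/\<^sup>2 \<Gamma>\<^sub>2 \<rho>\<^sup>1\<^sup>/\<^sup>2\<close> is a \<open>2 \<times> 2\<close> block plus a diagonal part, and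
  \<open>M = \<rho>\<^sup>1\<^sup>/\<^sup>2 \<Gamma>\<^sub>1 \<rho>\<^sup>1\<^sup>/\<^sup>2\<close> has only two nonzero eigenvalues, so that \<open>M log M\<close> is a linear combination of
  \<open>M\<close> and \<open>M\<^sup>2\<close>.  If \<open>\<rho>\<close> has eigenvalues \<open>(1 \<plusminus> r)/2\<close> and the Bloch vector of \<open>\<rho>\<close> makes an angle with
  cosine \<open>C\<close> with the Z axis, the trace is \<open>r/2\<close> times
  \<open>r ((0.01 + 1.155 C\<^sup>2) G - 0.96 C\<^sup>2 G\<^sub>1) + 0.6 (1 - C\<^sup>2) ln ((1 + r)/(1 - r))\<close>, where \<open>G\<close> and \<open>G\<^sub>1\<close> are the
  slopes of the logarithm between the eigenvalues of the two blocks.  Monotonicity of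
  \<open>ln ((1 + t)/(1 - t))/t\<close> gives \<open>G\<^sub>1 \<le> 0.975 G\<close>, so the trace is positive unless \<open>r = 0\<close>.  As \<open>I/2\<close> is
  diagonal in every basis, the same formula shows that \<open>\<Omega>(I/2)\<close> is a multiple of \<open>I\<close>.
\<close>

subsection \<open>Matrix algebra\<close>

lemma conj_transpose_mult: "conj_transpose (A ** B) = conj_transpose B ** conj_transpose A"
  by (simp add: conj_transpose_def matrix_matrix_mult_def vec_eq_iff mult.commute)

lemma conj_transpose_conj_transpose [simp]: "conj_transpose (conj_transpose A) = A"
  by (simp add: conj_transpose_def)

lemma conj_transpose_mat_1 [simp]: "conj_transpose (mat 1) = mat 1"
  by (simp add: conj_transpose_def mat_def vec_eq_iff)

lemma conj_transpose_scaleR: "conj_transpose (c *\<^sub>R A) = c *\<^sub>R conj_transpose A"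
  by (simp add: conj_transpose_def vec_eq_iff)

lemma conj_transpose_add: "conj_transpose (A + B) = conj_transpose A + conj_transpose B"
  by (simp add: conj_transpose_def vec_eq_iff)

lemma conj_transpose_diff: "conj_transpose (A - B) = conj_transpose A - conj_transpose B"
  by (simp add: conj_transpose_def vec_eq_iff)

lemma conj_transpose_real_diag [simp]: "conj_transpose (real_diag d) = real_diag d"
  by (simp add: conj_transpose_def real_diag_def vec_eq_iff)

lemma trace_conj_transpose: "trace (conj_transpose A) = cnj (trace A)"
  by (simp add: trace_def conj_transpose_def)

lemma scaleR_matrix_mult [simp]:
  fixes A :: "complex^'n^'m"
  shows "(c *\<^sub>R A) ** B = c *\<^sub>R (A ** B)" and "A ** (c *\<^sub>R B) = c *\<^sub>R (A ** B)"
  by (simp_all add: matrix_matrix_mult_def vec_eq_iff scaleR_sum_right)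

lemma matrix_add_rdistrib: "(A + B) ** C = A ** C + B ** (C :: complex^'n^'m)"
  by (simp add: matrix_matrix_mult_def vec_eq_iff sum.distrib distrib_right)

lemma matrix_diff_ldistrib: "(A :: complex^'n^'m) ** (B - C) = A ** B - A ** C"
  by (simp add: matrix_matrix_mult_def vec_eq_iff sum_subtractf right_diff_distrib)

lemma matrix_diff_rdistrib: "(A - B) ** C = A ** C - B ** (C :: complex^'n^'m)"
  by (simp add: matrix_matrix_mult_def vec_eq_iff sum_subtractf left_diff_distrib)

lemma matrix_mult_uminus_right: "(A :: complex^'n^'m) ** (- B) = - (A ** B)"
  by (simp add: matrix_matrix_mult_def vec_eq_iff sum_negf)

lemma trace_uminus: "trace (- A) = - trace (A :: complex^'n^'n)"
  by (simp add: trace_def sum_negf)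

lemma trace_scaleR: "trace (c *\<^sub>R A) = c *\<^sub>R trace (A :: complex^'n^'n)"
  by (simp add: trace_def scaleR_sum_right)

lemma unitary_mult: "unitary U \<Longrightarrow> unitary V \<Longrightarrow> unitary (U ** V)"
  unfolding unitary_def
  by (metis conj_transpose_mult matrix_mul_assoc matrix_mul_lid)

lemma unitary_mat_1 [simp]: "unitary (mat 1)"
  by (simp add: unitary_def)

lemma unitary_cancel:
  assumes "unitary U"
  shows "conj_transpose U ** (U ** A) = A" and "U ** (conj_transpose U ** A) = A"
  using assms by (simp_all add: unitary_def matrix_mul_assoc)

lemma unitaryI: "conj_transpose U ** U = mat 1 \<Longrightarrow> unitary U"
  by (simp add: unitary_def matrix_left_right_inverse)

subsection \<open>Unitary diagonalization\<close>

text \<open>Keeping \<open>U\<close> and \<open>d\<close> explicit turns the functional calculus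
  into arithmetic on eigenvalue functions, and \<open>diagonalizes_unique\<close> then proves matrix
  identities by exhibiting the same \<open>U\<close> and \<open>d\<close> on both sides.\<close>

definition diagonalizes :: "complex^'n^'n \<Rightarrow> ('n \<Rightarrow> real) \<Rightarrow> complex^'n^'n \<Rightarrow> bool"
  where "diagonalizes U d A \<longleftrightarrow> unitary U \<and> A = U ** real_diag d ** conj_transpose U"

lemma diagonalizes_herm_fun:
  "diagonalizes U d A \<Longrightarrow> diagonalizes U (f \<circ> d) (herm_fun f A)"
  by (auto simp: diagonalizes_def intro: herm_fun_eqI)

lemma diagonalizes_hermitian: "diagonalizes U d A \<Longrightarrow> hermitian A"
  by (auto simp: diagonalizes_def hermitian_def conj_transpose_mult matrix_mul_assoc)

lemma diagonalizes_conj: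
  assumes "diagonalizes U d A" and "unitary V"
  shows "diagonalizes (V ** U) d (V ** A ** conj_transpose V)"
  using assms by (auto simp: diagonalizes_def unitary_mult conj_transpose_mult matrix_mul_assoc)

lemma herm_fun_conj:
  assumes "diagonalizes U d A" and "unitary V"
  shows "herm_fun f (V ** A ** conj_transpose V) = V ** herm_fun f A ** conj_transpose V"
  using diagonalizes_herm_fun[OF diagonalizes_conj[OF assms]] diagonalizes_herm_fun[OF assms(1)]
  by (simp add: diagonalizes_def conj_transpose_mult matrix_mul_assoc)

lemma real_diag_mult: "real_diag d ** real_diag e = real_diag (\<lambda>i. d i * e i)"
  by (simp add: vec_eq_iff real_diag_mult_nth) (simp add: real_diag_def)

lemma real_diag_const: "real_diag (\<lambda>_. c) = c *\<^sub>R mat 1"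
  by (simp add: vec_eq_iff real_diag_def mat_def of_real_def)

lemma diagonalizes_mult:
  assumes "diagonalizes U d A" and "diagonalizes U e B"
  shows "diagonalizes U (\<lambda>i. d i * e i) (A ** B)"
  using assms
  by (auto simp: diagonalizes_def matrix_mul_assoc[symmetric] unitary_cancel real_diag_mult[symmetric])

lemma diagonalizes_unique: "diagonalizes U d A \<Longrightarrow> diagonalizes U d B \<Longrightarrow> A = B"
  by (simp add: diagonalizes_def)

lemma diagonalizes_affine:
  assumes "diagonalizes U d A" and "diagonalizes U e B"
  shows "diagonalizes U (\<lambda>i. c1 * d i + c2 * e i) (c1 *\<^sub>R A + c2 *\<^sub>R B)"
proof -
  have "real_diag (\<lambda>i. c1 * d i + c2 * e i) = c1 *\<^sub>R real_diag d + c2 *\<^sub>R real_diag e"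
    by (simp add: vec_eq_iff real_diag_def of_real_def scaleR_add_left)
  with assms show ?thesis
    by (auto simp: diagonalizes_def matrix_add_ldistrib matrix_add_rdistrib matrix_mul_assoc)
qed

lemma diagonalizes_mat_1: "unitary U \<Longrightarrow> diagonalizes U (\<lambda>_. 1) (mat 1)"
  by (simp add: diagonalizes_def real_diag_const unitary_def)

lemma diagonalizes_scaleR_mat_1: "diagonalizes (mat 1) (\<lambda>_. c) (c *\<^sub>R mat 1)"
  by (simp add: diagonalizes_def real_diag_const)

lemma herm_fun_scaleR_mat_1: "herm_fun f (c *\<^sub>R mat 1) = f c *\<^sub>R mat 1"
  using diagonalizes_herm_fun[OF diagonalizes_scaleR_mat_1, of f c]
  by (simp add: diagonalizes_def real_diag_const comp_def)

text \<open>Only the values of \<open>f\<close> on the spectrum matter. With two eigenvalues an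
  affine interpolation of \<open>f\<close> always fits, so no eigenvectors have to be computed
  later.\<close>

lemma herm_fun_affine:
  assumes "diagonalizes U d A" and "\<And>i. f (d i) = c1 + c2 * d i"
  shows "herm_fun f A = c1 *\<^sub>R mat 1 + c2 *\<^sub>R A"
proof -
  have "unitary U" using assms(1) by (simp add: diagonalizes_def)
  from diagonalizes_affine[OF diagonalizes_mat_1[OF this] assms(1), of c1 c2]
    diagonalizes_herm_fun[OF assms(1), of f] show ?thesis
    by (intro diagonalizes_unique) (auto simp: comp_def assms(2))
qed

section \<open>Eigenvalues read off from trace, determinant and quadratic form\<close>

lemma trace_diagonalizes:
  assumes "diagonalizes U d A" shows "trace A = of_real (\<Sum>i\<in>UNIV. d i)"
proof -
  have "trace A = trace (real_diag d ** (conj_transpose U ** U))"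
    using assms by (simp add: diagonalizes_def matrix_mul_assoc[symmetric] trace_mul_sym[of U])
  then show ?thesis
    using assms by (simp add: diagonalizes_def unitary_def trace_def real_diag_def)
qed

lemma det_diagonalizes:
  assumes "diagonalizes U d A" shows "det A = of_real (\<Prod>i\<in>UNIV. d i)"
proof -
  have "det A = det (real_diag d) * det (U ** conj_transpose U)"
    using assms by (simp add: diagonalizes_def det_mul)
  also have "det (real_diag d) = (\<Prod>i\<in>UNIV. of_real (d i))"
    by (subst det_diagonal) (auto simp: real_diag_def)
  finally show ?thesis
    using assms by (simp add: diagonalizes_def unitary_def)
qed

lemma diagonalizes_positive:
  assumes "diagonalizes U d A" and "positive_definite A" shows "0 < d i"
proof -
  \<comment> \<open>The test vector is column \<open>i\<close> of \<open>U\<close>, an eigenvector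
    for \<open>d i\<close>.\<close>
  define x where "x = U *v axis i 1"
  have UU: "conj_transpose U ** U = mat 1" using assms by (simp add: diagonalizes_def unitary_def)
  have *: "conj_transpose U *v x = axis i 1"
    by (simp add: x_def matrix_vector_mul_assoc UU)
  have "x \<noteq> 0" using * by (auto simp: axis_eq_0_iff)
  have xk: "x $ k = U $ k $ i" for k
    by (simp add: x_def matrix_vector_mult_def axis_def if_distrib cong: if_cong)
  have "real_diag d *v axis i 1 = axis i (complex_of_real (d i))"
    by (simp add: vec_eq_iff matrix_vector_mult_def real_diag_def axis_def
        if_distrib[of "\<lambda>x. _ * x"] cong: if_cong)
  then have "A *v x = U *v axis i (complex_of_real (d i))"
    using assms(1) by (simp add: diagonalizes_def matrix_vector_mul_assoc[symmetric] *)
  then have Ax: "(A *v x) $ k = U $ k $ i * d i" for k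
    by (simp add: matrix_vector_mult_def axis_def if_distrib cong: if_cong)
  have "(\<Sum>k\<in>UNIV. cnj (x $ k) * (A *v x) $ k) = (conj_transpose U ** U) $ i $ i * d i"
    by (simp add: Ax xk matrix_matrix_mult_def conj_transpose_def sum_distrib_right mult.assoc)
  also have "\<dots> = d i" by (simp add: UU mat_def)
  finally have "quadratic_form A x = d i" by (simp add: quadratic_form_def)
  with assms(2) \<open>x \<noteq> 0\<close> show ?thesis by (auto simp: positive_definite_def)
qed

section \<open>The spectral theorem for Hermitian 2 x 2 matrices\<close>

lemma unitary_2:
  fixes U :: "complex^2^2"
  assumes "cmod (U $ 1 $ 1) ^ 2 + cmod (U $ 2 $ 1) ^ 2 = 1"
    and "U $ 1 $ 2 = - cnj (U $ 2 $ 1)" "U $ 2 $ 2 = cnj (U $ 1 $ 1)"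
  shows "unitary U"
proof (rule unitaryI)
  have "cnj (U $ 1 $ 1) * U $ 1 $ 1 + cnj (U $ 2 $ 1) * U $ 2 $ 1 = 1"
    using assms(1) by (simp add: mult.commute[of "cnj _"] complex_norm_square[symmetric] del: of_real_power)
      (metis of_real_1 of_real_add)
  then show "conj_transpose U ** U = mat 1"
    by (simp add: vec_eq_iff forall_2 matrix_matrix_mult_def sum_2 conj_transpose_def mat_def assms(2,3) algebra_simps)
qed

lemma hermitian_nth:
  assumes "hermitian A" shows "cnj (A $ j $ i) = A $ i $ j"
proof -
  have "conj_transpose A $ i $ j = A $ i $ j" using assms by (simp add: hermitian_def)
  then show ?thesis by (simp add: conj_transpose_def)
qed

lemma hermitian_2_diagonalizes:
  fixes A :: "complex^2^2"
  assumes "hermitian A"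
  obtains U d where "diagonalizes U d A"
proof -
  note H = hermitian_nth[OF assms]
  define a b w where "a = Re (A $ 1 $ 1)" and "b = Re (A $ 2 $ 2)" and "w = A $ 1 $ 2"
  have A11: "A $ 1 $ 1 = of_real a" and A22: "A $ 2 $ 2 = of_real b"
    using H[of 1 1] H[of 2 2] by (auto simp: a_def b_def complex_eq_iff)
  have A12: "A $ 1 $ 2 = w" and A21: "A $ 2 $ 1 = cnj w"
    using H[of 1 2] by (auto simp: w_def)
  show ?thesis
  proof (cases "w = 0")
    case True
    have "A = real_diag (\<lambda>i. if i = 1 then a else b)"
      by (simp add: vec_eq_iff forall_2 real_diag_def A11 A12 A21 A22 True)
    then have "diagonalizes (mat 1) (\<lambda>i. if i = 1 then a else b) A" by (simp add: diagonalizes_def)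
    then show ?thesis by (rule that)
  next
    case False
    \<comment> \<open>\<open>a + t\<close> is the larger root of the characteristic polynomial, and
      \<open>b - t\<close> the other one. The columns \<open>(w, t)\<close> and
      \<open>(-t, cnj w)\<close> of \<open>V\<close> below are eigenvectors for them;
      \<open>w = 0\<close> is treated apart because both columns can then vanish.\<close>
    define t where "t = (b - a + sqrt ((a - b)^2 + 4 * (cmod w)^2)) / 2"
    have "(2 * t + a - b)^2 = (a - b)^2 + 4 * (cmod w)^2"
    proof -
      have "2 * t + a - b = sqrt ((a - b)^2 + 4 * (cmod w)^2)" by (simp add: t_def field_simps)
      then show ?thesis by simp
    qed
    then have t: "(cmod w)^2 = t * (t + a - b)"
      by (simp add: power2_eq_square algebra_simps)
    then have ww: "w * cnj w = of_real t * (of_real t + of_real a - of_real b)"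
      using complex_norm_square[of w] by simp
    define n where "n = sqrt ((cmod w)^2 + t^2)"
    have n: "n > 0" "n^2 = (cmod w)^2 + t^2"
      using False by (auto simp: n_def intro!: add_pos_nonneg)
    define V :: "complex^2^2" where
      "V = vector [vector [w, - of_real t], vector [of_real t, cnj w]]"
    define U where "U = (1 / n) *\<^sub>R V"
    define d :: "2 \<Rightarrow> real" where "d = (\<lambda>i. if i = 1 then a + t else b - t)"
    have "(cmod w / n)^2 + (t / n)^2 = (n^2) / n^2"
      by (simp only: power_divide n(2) add_divide_distrib)
    then have U: "unitary U"
      using n(1) by (intro unitary_2) (auto simp: U_def V_def norm_divide power_divide)
    have "A ** V = V ** real_diag d"
      using ww by (simp add: vec_eq_iff forall_2 matrix_matrix_mult_def sum_2 V_def real_diag_def d_def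
          A11 A12 A21 A22 algebra_simps)
    then have "A ** U = U ** real_diag d"
      by (simp add: U_def)
    then have "A = U ** real_diag d ** conj_transpose U"
      using U by (metis matrix_mul_assoc matrix_mul_rid unitary_def)
    with U show ?thesis using that by (simp add: diagonalizes_def)
  qed
qed

subsection \<open>Tensor products\<close>

lemma sum_prod_UNIV: "(\<Sum>x\<in>(UNIV :: ('a::finite \<times> 'b::finite) set). f x) = (\<Sum>i\<in>UNIV. \<Sum>j\<in>UNIV. f (i, j))"
  by (simp add: sum.cartesian_product)

lemma sum_2_2:
  fixes f :: "2 \<times> 2 \<Rightarrow> 'a::comm_monoid_add"
  shows "(\<Sum>x\<in>UNIV. f x) = f (1,1) + f (1,2) + f (2,1) + f (2,2)"
  by (simp add: sum_prod_UNIV sum_2 add.assoc)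

lemma tensor_nth: "tensor X Y $ (i, b) $ (k, c) = X $ i $ k * Y $ b $ c"
  by (simp add: tensor_def)

lemma tensor_mult: "tensor A B ** tensor A' B' = tensor (A ** A') (B ** B')"
  by (simp add: vec_eq_iff tensor_def matrix_matrix_mult_def sum_prod_UNIV sum_product mult_ac)

lemma tensor_mat_1 [simp]: "tensor (mat 1) (mat 1) = mat 1"
  by (auto simp: vec_eq_iff tensor_def mat_def)

lemma conj_transpose_tensor: "conj_transpose (tensor A B) = tensor (conj_transpose A) (conj_transpose B)"
  by (simp add: vec_eq_iff tensor_def conj_transpose_def)

lemma unitary_tensor: "unitary A \<Longrightarrow> unitary B \<Longrightarrow> unitary (tensor A B)"
  by (simp add: unitary_def conj_transpose_tensor tensor_mult)

text \<open>The partial trace is dual to tensoring with the identity, so a trace against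
  \<open>Omega1\<close> can be evaluated on the product space.\<close>

lemma trace_mult_ptrace_B: "trace (X ** ptrace_B Y) = trace (tensor X (mat 1) ** Y)"
proof -
  have "trace (tensor X (mat 1) ** Y) = (\<Sum>i\<in>UNIV. \<Sum>b\<in>UNIV. \<Sum>k\<in>UNIV. X $ i $ k * Y $ (k, b) $ (i, b))"
    by (simp add: trace_def matrix_matrix_mult_def sum_prod_UNIV tensor_def mat_def
        if_distrib[of "\<lambda>x. _ * x"] if_distrib[of "\<lambda>x. x * _"] cong: if_cong)
  also have "\<dots> = trace (X ** ptrace_B Y)"
    by (simp add: trace_def matrix_matrix_mult_def ptrace_B_def sum_distrib_left)
       (intro sum.cong refl sum.swap)
  finally show ?thesis by simp
qed

lemma choi_nth: "choi N $ (i, b) $ (k, c) = N (matrix_unit i k) $ b $ c"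
proof -
  have "choi N $ (i, b) $ (k, c) =
      (\<Sum>i'\<in>UNIV. \<Sum>j'\<in>UNIV. if i = i' \<and> k = j' then N (matrix_unit i' j') $ b $ c else 0)"
    by (simp add: choi_def tensor_def sum_component matrix_unit_def if_distrib[of "\<lambda>x. x * _"] cong: if_cong)
  also have "\<dots> = (\<Sum>i'\<in>UNIV. if i = i' then N (matrix_unit i' k) $ b $ c else 0)"
    by (intro sum.cong) auto
  finally show ?thesis by simp
qed

subsection \<open>Block matrices and the Choi matrices\<close>

text \<open>The matrix acting as \<open>m\<close> on the span of \<open>|00>\<close> and \<open>|11>\<close>, with eigenvalues \<open>c\<close> on \<open>|01>\<close>
  and \<open>e\<close> on \<open>|10>\<close>.\<close>

definition blk :: "complex^2^2 \<Rightarrow> complex \<Rightarrow> complex \<Rightarrow> complex^(2 \<times> 2)^(2 \<times> 2)"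
  where "blk m c e = (\<chi> x y. if fst x = snd x \<and> fst y = snd y then m $ fst x $ fst y
           else if x = y then (if fst x = 1 then c else e) else 0)"

definition sym2 :: "real \<Rightarrow> real \<Rightarrow> real \<Rightarrow> complex^2^2"
  where "sym2 a b w = vector [vector [of_real a, of_real w], vector [of_real w, of_real b]]"

lemma sym2_nth [simp]:
  "sym2 a b w $ 1 $ 1 = of_real a" "sym2 a b w $ 1 $ 2 = of_real w"
  "sym2 a b w $ 2 $ 1 = of_real w" "sym2 a b w $ 2 $ 2 = of_real b"
  by (simp_all add: sym2_def)

lemma hermitian_sym2: "hermitian (sym2 a b w)"
  by (simp add: hermitian_def conj_transpose_def vec_eq_iff forall_2)

lemma trace_sym2: "trace (sym2 a b w) = of_real (a + b)"
  by (simp add: trace_def sum_2)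

lemma det_sym2: "det (sym2 a b w) = of_real (a * b - w^2)"
  by (simp add: det_2 power2_eq_square)

lemma blk_mult: "blk m c e ** blk m' c' e' = blk (m ** m') (c * c') (e * e')"
  by (simp add: vec_eq_iff forall_2 matrix_matrix_mult_def sum_2 sum_2_2 blk_def)

lemma blk_mat_1 [simp]: "blk (mat 1) 1 1 = mat 1"
  by (simp add: vec_eq_iff forall_2 blk_def mat_def)

lemma conj_transpose_blk: "conj_transpose (blk m c e) = blk (conj_transpose m) (cnj c) (cnj e)"
  by (simp add: vec_eq_iff forall_2 blk_def conj_transpose_def)

lemma blk_add: "blk m c e + blk m' c' e' = blk (m + m') (c + c') (e + e')"
  by (simp add: vec_eq_iff blk_def)

lemma blk_scaleR: "a *\<^sub>R blk m c e = blk (a *\<^sub>R m) (a *\<^sub>R c) (a *\<^sub>R e)"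
  by (simp add: vec_eq_iff blk_def)

lemma unitary_blk: "unitary U \<Longrightarrow> unitary (blk U 1 1)"
  by (simp add: unitary_def conj_transpose_blk blk_mult)

lemma blk_real_diag:
  "blk (real_diag d) (of_real c) (of_real e) =
    real_diag (\<lambda>x. if fst x = snd x then d (fst x) else if fst x = 1 then c else e)"
  by (simp add: vec_eq_iff forall_2 blk_def real_diag_def)

lemma diagonalizes_blk:
  assumes "diagonalizes U d m"
  shows "diagonalizes (blk U 1 1) (\<lambda>x. if fst x = snd x then d (fst x) else if fst x = 1 then c else e)
    (blk m (of_real c) (of_real e))"
  using assms unfolding diagonalizes_def blk_real_diag[symmetric]
  by (simp add: unitary_blk conj_transpose_blk blk_mult)

text \<open>The functional calculus respects the orthogonal sum of the 2 x 2 block and the two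
  one-dimensional parts.\<close>

lemma herm_fun_blk:
  assumes "diagonalizes U d m"
  shows "herm_fun f (blk m (of_real c) (of_real e)) = blk (herm_fun f m) (of_real (f c)) (of_real (f e))"
proof -
  have "f \<circ> (\<lambda>x::2\<times>2. if fst x = snd x then d (fst x) else if fst x = 1 then c else e) =
      (\<lambda>x. if fst x = snd x then (f \<circ> d) (fst x) else if fst x = 1 then f c else f e)"
    by auto
  with diagonalizes_herm_fun[OF diagonalizes_blk[OF assms], of f c e]
  have "diagonalizes (blk U 1 1)
      (\<lambda>x. if fst x = snd x then (f \<circ> d) (fst x) else if fst x = 1 then f c else f e)
      (herm_fun f (blk m (of_real c) (of_real e)))"
    by simp
  then show ?thesis
    using diagonalizes_blk[OF diagonalizes_herm_fun[OF assms]] by (rule diagonalizes_unique)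
qed

lemma tensor_real_diag_mat_1: "tensor (real_diag d) (mat 1) = blk (real_diag d) (of_real (d 1)) (of_real (d 2))"
  by (simp add: vec_eq_iff forall_2 blk_def real_diag_def tensor_def mat_def)

lemma trace_mult_blk:
  "trace (Y ** blk m c e) = Y $ (1,1) $ (1,1) * m $ 1 $ 1 + Y $ (1,1) $ (2,2) * m $ 2 $ 1
     + Y $ (2,2) $ (1,1) * m $ 1 $ 2 + Y $ (2,2) $ (2,2) * m $ 2 $ 2
     + Y $ (1,2) $ (1,2) * c + Y $ (2,1) $ (2,1) * e"
  by (simp add: trace_def matrix_matrix_mult_def sum_2_2 blk_def)

text \<open>Between the vectors \<open>|ii>\<close> and \<open>|jj>\<close> the identity on the
  second factor leaves only \<open>i = j\<close>, so just the diagonal of \<open>R\<close>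
  survives.\<close>

lemma blk_tensor_blk:
  "blk m 0 0 ** tensor R (mat 1) ** blk m' 0 0 =
    blk (m ** (\<chi> i j. if i = j then R $ i $ i else 0) ** m') 0 0"
  by (simp add: vec_eq_iff forall_2 blk_def matrix_matrix_mult_def sum_2 sum_2_2 tensor_def mat_def)

lemma choi_dephasing: "choi (dephasing q) = blk (sym2 1 1 (2 * q - 1)) 0 0"
  by (simp add: vec_eq_iff forall_2 choi_nth dephasing_def blk_def matrix_unit_def pauli_Z_def
      matrix_matrix_mult_def sum_2 scaleR_conv_of_real[where 'a=complex] algebra_simps)

lemma choi_depolarizing:
  "choi (depolarizing p) = blk (sym2 (1 - p/2) (1 - p/2) (1 - p)) (of_real (p/2)) (of_real (p/2))"
  by (simp add: vec_eq_iff forall_2 choi_nth depolarizing_def blk_def matrix_unit_def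
      trace_def sum_2 mat_def scaleR_conv_of_real[where 'a=complex] algebra_simps)

subsection \<open>Slopes of the logarithm\<close>

text \<open>The divided difference of \<open>ln\<close> at the roots \<open>(t + y)/2\<close> and
  \<open>(t - y)/2\<close> of \<open>x^2 - t x + D\<close>. For a 2 x 2 matrix, \<open>t\<close> is
  the trace and \<open>D\<close> the determinant, so the slope is available without naming the
  eigenvalues.\<close>

definition log_slope :: "real \<Rightarrow> real \<Rightarrow> real"
  where "log_slope t D = (let y = sqrt (t^2 - 4 * D) in ln ((t + y) / (t - y)) / y)"

lemma log_slope_interpolates:
  fixes x y t D :: real
  assumes "x + y = t" "x * y = D" "0 < t" "0 < D" "4 * D < t^2"
  shows "0 < x" "0 < y" "ln x - ln y = log_slope t D * (x - y)"
proof -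
  have sgn: "0 < x \<and> 0 < y"
    using assms by (smt (verit) mult_le_0_iff mult_pos_neg zero_less_mult_iff)
  then show "0 < x" "0 < y" by auto
  have eq: "t^2 - 4 * D = (x - y)^2"
    using assms(1,2) by (auto simp: power2_eq_square algebra_simps)
  then have ne: "x \<noteq> y" using assms(5) by auto
  have "sqrt (t^2 - 4 * D) = \<bar>x - y\<bar>" by (simp add: eq)
  then have *: "log_slope t D = ln ((t + \<bar>x - y\<bar>) / (t - \<bar>x - y\<bar>)) / \<bar>x - y\<bar>"
    by (simp add: log_slope_def Let_def)
  then show "ln x - ln y = log_slope t D * (x - y)"
  proof (cases "x < y")
    case True
    then have "log_slope t D = ln (2 * y / (2 * x)) / (y - x)"
      using * assms(1)[symmetric] by simp
    then show ?thesis using True sgn by (simp add: ln_div field_simps)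
  next
    case False
    then have "log_slope t D = ln (2 * x / (2 * y)) / (x - y)"
      using * assms(1)[symmetric] by simp
    then show ?thesis using ne sgn by (simp add: ln_div)
  qed
qed

text \<open>The last assumption says that the discriminant is positive. The eigenvalues are then
  distinct, and the line through the two points of the graph of \<open>ln\<close> above them has
  slope \<open>log_slope\<close>.\<close>

lemma sym2_diagonalizes_ln:
  assumes "0 < a + b" "w^2 < a * b" "4 * (a * b - w^2) < (a + b)^2"
  obtains U d c where "diagonalizes U d (sym2 a b w)" "\<And>i. 0 < d i"
    "\<And>i. ln (d i) = c + log_slope (a + b) (a * b - w^2) * d i"
proof -
  obtain U d where U: "diagonalizes U d (sym2 a b w)"
    using hermitian_2_diagonalizes[OF hermitian_sym2] .
  have "complex_of_real (d 1 + d 2) = of_real (a + b)"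
    using trace_diagonalizes[OF U] by (simp add: trace_sym2 sum_2)
  then have s: "d 1 + d 2 = a + b" using of_real_eq_iff by blast
  have "complex_of_real (d 1 * d 2) = of_real (a * b - w^2)"
    using det_diagonalizes[OF U] by (simp add: det_sym2 UNIV_2)
  then have p: "d 1 * d 2 = a * b - w^2" using of_real_eq_iff by blast
  let ?G = "log_slope (a + b) (a * b - w^2)"
  have *: "0 < d 1" "0 < d 2" "ln (d 1) - ln (d 2) = ?G * (d 1 - d 2)"
    using log_slope_interpolates[OF s p] assms by auto
  show ?thesis
  proof (rule that[OF U, of "ln (d 1) - ?G * d 1"])
    show "0 < d i" for i using *(1,2) exhaust_2[of i] by auto
    show "ln (d i) = ln (d 1) - ?G * d 1 + ?G * d i" for i
      using *(3) exhaust_2[of i] by (auto simp: algebra_simps)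
  qed
qed

section \<open>Monotonicity and scaling of the slope\<close>

lemma DERIV_ln_ratio:
  fixes x :: real assumes "-1 < x" "x < 1"
  shows "((\<lambda>t. ln (1 + t) - ln (1 - t)) has_real_derivative 2 / (1 - x^2)) (at x)"
proof -
  have "((\<lambda>t. ln (1 + t) - ln (1 - t)) has_real_derivative 1 / (1 + x) + 1 / (1 - x)) (at x)"
    using assms by (auto intro!: derivative_eq_intros)
  also have "1 - x^2 = (1 + x) * (1 - x)" by (simp add: power2_eq_square algebra_simps)
  then have "1 / (1 + x) + 1 / (1 - x) = 2 / (1 - x^2)"
    using assms by (simp add: add_frac_eq)
  finally show ?thesis .
qed

text \<open>The difference of the two sides vanishes at 0 and has derivative
  \<open>4 x^2 / (1 - x^2)^2\<close>. It is, up to the factor \<open>1/t^2\<close>, the derivative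
  of \<open>(ln (1 + t) - ln (1 - t)) / t\<close>.\<close>

lemma ln_ratio_le:
  fixes t :: real assumes "0 \<le> t" "t < 1"
  shows "ln (1 + t) - ln (1 - t) \<le> 2 / (1 - t^2) * t"
proof -
  let ?f = "\<lambda>t. 2 / (1 - t^2) * t - (ln (1 + t) - ln (1 - t))"
  have "?f 0 \<le> ?f t"
  proof (rule DERIV_nonneg_imp_nondecreasing[OF assms(1)])
    fix x :: real assume x: "0 \<le> x" "x \<le> t"
    then have x1: "x < 1" "x^2 < 1" using assms by (auto simp: abs_square_less_1)
    have eq: "4 * x / (1 - x^2)^2 * x + 2 * (1 - x^2) / (1 - x^2)^2 = (2 * x^2 + 2) / (1 - x^2)^2"
      by (simp add: add_divide_distrib[symmetric] power2_eq_square)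
    moreover have "2 * (1 - x^2) / (1 - x^2)^2 = 2 / (1 - x^2)"
    proof -
      have "2 * u / u^2 = 2 / u" for u :: real by (simp add: power2_eq_square)
      then show ?thesis .
    qed
    moreover have "((\<lambda>t. 2 / (1 - t^2) * t) has_real_derivative (2 * x^2 + 2) / (1 - x^2)^2) (at x)"
      using x1(2) by (auto intro!: derivative_eq_intros simp: power2_eq_square)
    ultimately have "((\<lambda>t. 2 / (1 - t^2) * t) has_real_derivative 4 * x / (1 - x^2)^2 * x + 2 / (1 - x^2)) (at x)"
      by simp
    from DERIV_diff[OF this DERIV_ln_ratio[of x]] x x1
    have "(?f has_real_derivative 4 * x / (1 - x^2)^2 * x) (at x)" by simp
    moreover have "0 \<le> 4 * x / (1 - x^2)^2 * x" using x by simp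
    ultimately show "\<exists>y. (?f has_real_derivative y) (at x) \<and> 0 \<le> y" by blast
  qed
  then show ?thesis by simp
qed

text \<open>The substitution \<open>t = sqrt (1 - 4 * D)\<close>, which decreases in
  \<open>D\<close>, turns the slope into \<open>(ln (1 + t) - ln (1 - t)) / t\<close>, which is
  nondecreasing in \<open>t\<close>.\<close>

lemma log_slope_1_mono:
  assumes "0 < D" "D \<le> D'" "D' < 1/4"
  shows "log_slope 1 D' \<le> log_slope 1 D"
proof -
  let ?h = "\<lambda>t::real. (ln (1 + t) - ln (1 - t)) / t"
  have s: "0 < sqrt (1 - 4 * D')" "sqrt (1 - 4 * D') \<le> sqrt (1 - 4 * D)" "sqrt (1 - 4 * D) < 1"
    using assms by (auto simp: real_less_lsqrt)
  have "?h (sqrt (1 - 4 * D')) \<le> ?h (sqrt (1 - 4 * D))"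
  proof (rule DERIV_nonneg_imp_nondecreasing[OF s(2)])
    fix x assume "sqrt (1 - 4 * D') \<le> x" "x \<le> sqrt (1 - 4 * D)"
    with s have x: "0 < x" "x < 1" by linarith+
    have "(?h has_real_derivative (2 / (1 - x^2) * x - (ln (1 + x) - ln (1 - x))) / x^2) (at x)"
      using DERIV_divide[OF DERIV_ln_ratio[of x] DERIV_ident] x by (simp add: power2_eq_square)
    moreover have "0 \<le> (2 / (1 - x^2) * x - (ln (1 + x) - ln (1 - x))) / x^2"
      using ln_ratio_le[of x] x by simp
    ultimately show "\<exists>y. (?h has_real_derivative y) (at x) \<and> 0 \<le> y" by blast
  qed
  moreover have "ln ((1 + y) / (1 - y)) = ln (1 + y) - ln (1 - y)" if "0 < y" "y < 1" for y :: real
    using that by (simp add: ln_div)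
  moreover have "0 < sqrt (1 - 4 * D)" "sqrt (1 - 4 * D') < 1" using s by linarith+
  ultimately show ?thesis using s by (simp only: log_slope_def Let_def power_one)
qed

lemma log_slope_pos:
  assumes "0 < t" "0 < D" "4 * D < t^2" shows "0 < log_slope t D"
proof -
  define y where "y = sqrt (t^2 - 4 * D)"
  have y: "0 < y" "y < t" using assms by (auto simp: y_def intro!: real_less_lsqrt)
  then have "1 < (t + y) / (t - y)" by simp
  then have "0 < ln ((t + y) / (t - y))" using ln_gt_zero by blast
  then show ?thesis using y by (simp add: log_slope_def Let_def y_def[symmetric])
qed

text \<open>Scaling both eigenvalues by \<open>t\<close> leaves the difference of their logarithms
  unchanged, so the slope is divided by \<open>t\<close>. This reduces trace \<open>t\<close> to
  trace 1, where monotonicity applies.\<close>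

lemma log_slope_scale:
  assumes "0 < t" shows "log_slope t D = log_slope 1 (D / t^2) / t"
proof -
  have "t^2 - 4 * D = t^2 * (1 - 4 * (D / t^2))"
    using assms by (simp add: right_diff_distrib)
  then have *: "sqrt (t^2 - 4 * D) = t * sqrt (1 - 4 * (D / t^2))"
    using assms by (simp only: real_sqrt_mult) simp
  define y where "y = sqrt (1 - 4 * (D / t^2))"
  have "(t + t * y) / (t - t * y) = (t * (1 + y)) / (t * (1 - y))" by (simp add: algebra_simps)
  also have "\<dots> = (1 + y) / (1 - y)" using assms by simp
  finally show ?thesis unfolding log_slope_def Let_def power_one * y_def[symmetric] by simp
qed

subsection \<open>The operator \<open>\<Omega>\<close> and the AB map\<close>

lemma hermitian_Omega: "hermitian (Omega N1 N2 \<rho>)"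
  by (simp add: hermitian_def Omega_def conj_transpose_scaleR conj_transpose_add add.commute)

text \<open>For Hermitian \<open>X\<close>, the adjoint of \<open>Omega1\<close> contributes the
  complex conjugate trace, so symmetrizing amounts to taking the real part.\<close>

lemma trace_mult_Omega:
  assumes "hermitian X"
  shows "trace (X ** Omega N1 N2 \<rho>) = of_real (Re (trace (X ** Omega1 N1 N2 \<rho>)))"
proof -
  let ?O = "Omega1 N1 N2 \<rho>"
  have "trace (X ** conj_transpose ?O) = trace (conj_transpose (?O ** X))"
    using assms by (simp add: conj_transpose_mult hermitian_def)
  also have "\<dots> = cnj (trace (X ** ?O))"
    by (subst trace_mul_sym) (simp only: trace_conj_transpose)
  finally have "trace (X ** Omega N1 N2 \<rho>) = (1/2) *\<^sub>R (trace (X ** ?O) + cnj (trace (X ** ?O)))"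
    by (simp add: Omega_def trace_scaleR matrix_add_ldistrib trace_add)
  then show ?thesis
    by (simp add: complex_eq_iff)
qed

lemma trace_mult_Omega1:
  "trace (X ** Omega1 N1 N2 \<rho>) = - trace (tensor X (mat 1) ** choi N1 ** powr_A \<rho> (1/2)
     ** (mlog (sandwich N1 \<rho>) - mlog (sandwich N2 \<rho>)) ** powr_A \<rho> (-1/2))"
  by (simp add: Omega1_def matrix_mult_uminus_right trace_uminus trace_mult_ptrace_B matrix_mul_assoc)

section \<open>Powers of \<rho>, the objective, and the fixed-point equation\<close>

lemma diagonalizes_mpowr: "diagonalizes U d \<rho> \<Longrightarrow> diagonalizes U (\<lambda>i. d i powr s) (mpowr \<rho> s)"
  using diagonalizes_herm_fun[of U d \<rho> "\<lambda>x. x powr s"] by (simp add: mpowr_def comp_def)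

lemma mpowr_mult:
  assumes "diagonalizes U d \<rho>" and "\<And>i. 0 < d i"
  shows "mpowr \<rho> s ** mpowr \<rho> t = mpowr \<rho> (s + t)"
proof (rule diagonalizes_unique)
  show "diagonalizes U (\<lambda>i. d i powr s * d i powr t) (mpowr \<rho> s ** mpowr \<rho> t)"
    by (intro diagonalizes_mult diagonalizes_mpowr assms)
  show "diagonalizes U (\<lambda>i. d i powr s * d i powr t) (mpowr \<rho> (s + t))"
    using diagonalizes_mpowr[OF assms(1), of "s + t"] by (simp add: powr_add)
qed

lemma mpowr_0:
  assumes "diagonalizes U d \<rho>" and "\<And>i. 0 < d i"
  shows "mpowr \<rho> 0 = mat 1"
proof (rule diagonalizes_unique)
  have "d i \<noteq> 0" for i using assms(2)[of i] by simp
  then show "diagonalizes U (\<lambda>_. 1) (mpowr \<rho> 0)"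
    using diagonalizes_mpowr[OF assms(1), of 0] by simp
  show "diagonalizes U (\<lambda>_. 1) (mat 1)"
    using assms(1) by (intro diagonalizes_mat_1) (simp add: diagonalizes_def)
qed

lemma mpowr_1:
  assumes "diagonalizes U d \<rho>" and "\<And>i. 0 < d i"
  shows "mpowr \<rho> 1 = \<rho>"
proof (rule diagonalizes_unique[OF _ assms(1)])
  have "d i powr 1 = d i" for i using assms(2)[of i] by simp
  then show "diagonalizes U d (mpowr \<rho> 1)"
    using diagonalizes_mpowr[OF assms(1), of 1] by simp
qed

text \<open>By cyclicity of the trace the factor \<open>\<rho>^(-1/2)\<close> moves to the front and
  merges with \<rho> into \<open>\<rho>^(1/2)\<close>, which completes
  \<open>sandwich N1 \<rho>\<close>.\<close>

lemma objective_eq_trace: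
  fixes N1 N2 :: "complex^'a^'a \<Rightarrow> complex^'b^'b"
  assumes "diagonalizes U d \<rho>" and "\<And>i. 0 < d i"
  shows "complex_of_real (objective N1 N2 \<rho>) = trace (\<rho> ** Omega N1 N2 \<rho>)"
proof -
  let ?S = "powr_A \<rho> (1/2) :: complex^('a\<times>'b)^('a\<times>'b)"
  let ?Si = "powr_A \<rho> (-1/2) :: complex^('a\<times>'b)^('a\<times>'b)"
  define L where "L = mlog (sandwich N1 \<rho>) - mlog (sandwich N2 \<rho>)"
  have "mpowr \<rho> (-1/2) ** mpowr \<rho> 1 = mpowr \<rho> (1/2)"
    using mpowr_mult[OF assms, of "-1/2" 1] by simp
  then have S: "?Si ** tensor \<rho> (mat 1) = ?S"
    by (simp add: powr_A_def tensor_mult mpowr_1[OF assms])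
  have "trace (\<rho> ** Omega1 N1 N2 \<rho>) = - trace (tensor \<rho> (mat 1) ** choi N1 ** ?S ** L ** ?Si)"
    by (simp add: trace_mult_Omega1 L_def)
  also have "\<dots> = - trace (?Si ** (tensor \<rho> (mat 1) ** choi N1 ** ?S ** L))"
    by (subst trace_mul_sym) simp
  also have "\<dots> = - trace (sandwich N1 \<rho> ** L)"
    by (simp only: sandwich_def matrix_mul_assoc S)
  finally have "trace (\<rho> ** Omega1 N1 N2 \<rho>) = - trace (sandwich N1 \<rho> ** L)" .
  then show ?thesis
    unfolding trace_mult_Omega[OF diagonalizes_hermitian[OF assms(1)]]
    by (simp add: objective_def rel_entropy_def L_def)
qed

lemma mlog_positive:
  assumes "diagonalizes U d A" and "\<And>i. 0 < d i"
  shows "diagonalizes U (\<lambda>i. ln (d i)) (mlog A)"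
  using diagonalizes_herm_fun[OF assms(1), of "\<lambda>x. if 0 < x then ln x else 0"] assms(2)
  by (simp add: mlog_def comp_def)

text \<open>A fixed point equals \<open>exp H\<close> divided by its trace \<tau>. Taking logarithms
  gives \<open>mlog \<rho> = H - ln \<tau>\<close> times the identity, and comparison with the
  definition of \<open>H\<close> leaves only a scalar for \<Omega>.\<close>

lemma AB_map_fixed_point_Omega:
  fixes N1 N2 :: "complex^2^2 \<Rightarrow> complex^'b^'b"
  assumes "diagonalizes U d \<rho>" and "AB_map \<gamma> N1 N2 \<rho> = \<rho>" and "\<gamma> \<noteq> 0"
  obtains k where "Omega N1 N2 \<rho> = k *\<^sub>R mat 1"
proof -
  define H where "H = mlog \<rho> - (1/\<gamma>) *\<^sub>R Omega N1 N2 \<rho>"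
  have "hermitian (mlog \<rho>)"
    using assms(1) diagonalizes_herm_fun diagonalizes_hermitian unfolding mlog_def by blast
  then have "hermitian H"
    using hermitian_Omega[of N1 N2 \<rho>] by (simp add: H_def hermitian_def conj_transpose_diff conj_transpose_scaleR)
  then obtain V h where V: "diagonalizes V h H" using hermitian_2_diagonalizes by blast
  define \<tau> where "\<tau> = (\<Sum>i\<in>UNIV. exp (h i))"
  have \<tau>: "\<tau> > 0" by (simp add: \<tau>_def sum_2 add_pos_pos)
  have E: "diagonalizes V (\<lambda>i. exp (h i)) (mexp H)"
    using diagonalizes_herm_fun[OF V, of exp] by (simp add: mexp_def comp_def)
  have "normalize_trace (mexp H) = (1/\<tau>) *\<^sub>R mexp H"
    using trace_diagonalizes[OF E]
    by (simp add: normalize_trace_def vec_eq_iff \<tau>_def[symmetric] scaleR_conv_of_real[where 'a=complex])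
  then have "\<rho> = (1/\<tau>) *\<^sub>R mexp H"
    using assms(2) by (simp add: AB_map_def H_def)
  then have "diagonalizes V (\<lambda>i. exp (h i) / \<tau>) \<rho>"
    using diagonalizes_affine[OF E E, of "1/\<tau>" 0] by simp
  from mlog_positive[OF this] have "diagonalizes V (\<lambda>i. h i - ln \<tau>) (mlog \<rho>)"
    using \<tau> by (simp add: ln_div)
  moreover have "diagonalizes V (\<lambda>i. h i - ln \<tau>) (H - ln \<tau> *\<^sub>R mat 1)"
    using diagonalizes_affine[OF V diagonalizes_mat_1, of 1 "- ln \<tau>"] V by (simp add: diagonalizes_def)
  ultimately have "mlog \<rho> = H - ln \<tau> *\<^sub>R mat 1"
    by (rule diagonalizes_unique)
  then have "(1/\<gamma>) *\<^sub>R Omega N1 N2 \<rho> = (- ln \<tau>) *\<^sub>R mat 1"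
    by (simp add: H_def eq_neg_iff_add_eq_0 add.commute)
  then have "\<gamma> *\<^sub>R (1/\<gamma>) *\<^sub>R Omega N1 N2 \<rho> = \<gamma> *\<^sub>R (- ln \<tau>) *\<^sub>R mat 1"
    by (rule arg_cong)
  then have "Omega N1 N2 \<rho> = (- \<gamma> * ln \<tau>) *\<^sub>R mat 1"
    using assms(3) by simp
  then show ?thesis by (rule that)
qed

subsection \<open>The two logarithms\<close>

text \<open>A controlled unitary, with the second factor as control, maps \<open>|bb>\<close> to the normalized
  \<open>A|b> \<otimes> |b>\<close>.\<close>

lemma sandwich_blk_unitary:
  fixes A :: "complex^2^2"
  assumes "cmod (A $ 1 $ 1) ^ 2 + cmod (A $ 2 $ 1) ^ 2 = a"
    and "cmod (A $ 1 $ 2) ^ 2 + cmod (A $ 2 $ 2) ^ 2 = b"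
    and "0 < a" "0 < b"
  obtains W where "unitary W"
    "tensor A (mat 1) ** blk (sym2 1 1 g) 0 0 ** conj_transpose (tensor A (mat 1)) =
     W ** blk (sym2 a b (g * sqrt (a * b))) 0 0 ** conj_transpose W"
proof -
  define s where "s = sqrt a"
  define t where "t = sqrt b"
  have st: "0 < s" "0 < t" "a = s^2" "b = t^2" using assms by (simp_all add: s_def t_def)
  have norms: "A $ 1 $ 1 * cnj (A $ 1 $ 1) + A $ 2 $ 1 * cnj (A $ 2 $ 1) = (of_real s)^2"
    "A $ 1 $ 2 * cnj (A $ 1 $ 2) + A $ 2 $ 2 * cnj (A $ 2 $ 2) = (of_real t)^2"
    using assms(1,2) st by (simp_all add: complex_norm_square[symmetric] del: of_real_power
        flip: of_real_add of_real_power)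
  \<comment> \<open>Column \<open>b\<close> of \<open>F b\<close> is the normalized column
    \<open>b\<close> of \<open>A\<close>; the other column completes it to a unitary. Here
    \<open>b\<close> is the index of the control, not the squared norm.\<close>
  define F :: "2 \<Rightarrow> complex^2^2" where "F b = (if b = 1
     then vector [vector [A $ 1 $ 1 / s, - cnj (A $ 2 $ 1) / s], vector [A $ 2 $ 1 / s, cnj (A $ 1 $ 1) / s]]
     else vector [vector [cnj (A $ 2 $ 2) / t, A $ 1 $ 2 / t], vector [- cnj (A $ 1 $ 2) / t, A $ 2 $ 2 / t]])" for b
  have F: "conj_transpose (F b) ** F b = mat 1" for b
    using norms st exhaust_2[of b]
    by (auto simp: F_def vec_eq_iff forall_2 matrix_matrix_mult_def sum_2 conj_transpose_def mat_def
        power2_eq_square field_simps)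
  define W :: "complex^(2 \<times> 2)^(2 \<times> 2)"
    where "W = (\<chi> x y. if snd x = snd y then F (snd x) $ fst x $ fst y else 0)"
  have "(conj_transpose W ** W) $ (i, b) $ (k, c) = (if b = c then (conj_transpose (F b) ** F b) $ i $ k else 0)"
    for i b k c
    using exhaust_2[of b] exhaust_2[of c]
    by (auto simp: W_def matrix_matrix_mult_def sum_2 sum_2_2 conj_transpose_def)
  then have "conj_transpose W ** W = mat 1"
    by (auto simp: vec_eq_iff F mat_def)
  then have U: "unitary W" by (rule unitaryI)
  have ab: "sqrt (a * b) = s * t" using st by (simp add: real_sqrt_mult)
  have "tensor A (mat 1) ** blk (sym2 1 1 g) 0 0 ** conj_transpose (tensor A (mat 1)) =
     W ** blk (sym2 a b (g * sqrt (a * b))) 0 0 ** conj_transpose W"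
    using st(1,2) unfolding ab unfolding st(3,4)
    by (simp add: vec_eq_iff forall_2 matrix_matrix_mult_def sum_2 sum_2_2 conj_transpose_def
        W_def F_def tensor_def blk_def mat_def power2_eq_square)
  with U show ?thesis by (rule that)
qed

text \<open>On the two nonzero eigenvalues \<open>ln x = c + G x\<close>, hence
  \<open>x ln x = c x + G x^2\<close>. The kernel spoils the affine formula for
  \<open>mlog M\<close> itself, but after multiplication by \<open>M\<close> both sides vanish
  there.\<close>

lemma mult_mlog_sandwich_blk:
  fixes A :: "complex^2^2"
  assumes "cmod (A $ 1 $ 1) ^ 2 + cmod (A $ 2 $ 1) ^ 2 = a"
    and "cmod (A $ 1 $ 2) ^ 2 + cmod (A $ 2 $ 2) ^ 2 = b"
    and "0 < a" "0 < b" "a + b = 1" "g \<noteq> 0" "g^2 < 1"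
    and M: "M = tensor A (mat 1) ** blk (sym2 1 1 g) 0 0 ** conj_transpose (tensor A (mat 1))"
  obtains c where "M ** mlog M = c *\<^sub>R M + log_slope 1 ((1 - g^2) * a * b) *\<^sub>R (M ** M)"
proof -
  let ?m = "sym2 a b (g * sqrt (a * b))"
  obtain W where W: "unitary W" "M = W ** blk ?m 0 0 ** conj_transpose W"
    using sandwich_blk_unitary[OF assms(1-4), of g] unfolding M by blast
  have ab: "(g * sqrt (a * b))^2 = g^2 * (a * b)" using assms(3,4) by (simp add: power_mult_distrib)
  have D: "a * b - (g * sqrt (a * b))^2 = (1 - g^2) * a * b" unfolding ab by (simp add: algebra_simps)
  \<comment> \<open>Since \<open>g\<close> is nonzero, \<open>1 - g^2 < 1\<close>; the two
    eigenvalues thus differ even when \<open>a = b\<close>.\<close>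
  have "4 * (a * b) = (a + b)^2 - (a - b)^2"
    by (simp add: power2_eq_square algebra_simps)
  then have "4 * (a * b) \<le> 1"
    using assms(5) zero_le_power2[of "a - b"] by simp
  moreover have "(1 - g^2) * (4 * (a * b)) < 1 * (4 * (a * b))"
    using assms(3,4,6) by (intro mult_strict_right_mono) auto
  ultimately have lt: "4 * (a * b - (g * sqrt (a * b))^2) < (a + b)^2"
    unfolding D assms(5) by (simp add: mult_ac)
  obtain U d c where U: "diagonalizes U d ?m" "\<And>i. 0 < d i"
    "\<And>i. ln (d i) = c + log_slope 1 ((1 - g^2) * a * b) * d i"
  proof (rule sym2_diagonalizes_ln[of a b "g * sqrt (a * b)", OF _ _ lt])
    show "0 < a + b" using assms by simp
    have "g^2 * (a * b) < 1 * (a * b)" using assms(3,4,7) by (intro mult_strict_right_mono) auto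
    then show "(g * sqrt (a * b))^2 < a * b" by (simp add: ab)
  qed (use that in \<open>simp add: D assms(5)\<close>)
  define V e where "V = W ** blk U 1 1" and "e = (\<lambda>x::2\<times>2. if fst x = snd x then d (fst x) else 0)"
  have "diagonalizes (blk U 1 1) e (blk ?m 0 0)"
    using diagonalizes_blk[OF U(1), of 0 0] by (simp add: e_def cong: if_cong)
  from diagonalizes_conj[OF this W(1)] have V: "diagonalizes V e M"
    by (simp add: V_def W(2))
  let ?f = "\<lambda>x. if 0 < x then ln x else 0"
  have "diagonalizes V (\<lambda>x. e x * (?f \<circ> e) x) (M ** mlog M)"
    unfolding mlog_def by (intro diagonalizes_mult V diagonalizes_herm_fun)
  moreover have "e x * (?f \<circ> e) x = c * e x + log_slope 1 ((1 - g^2) * a * b) * (e x * e x)" for x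
    using U(2)[of "snd x"] by (simp add: e_def U(3)[of "snd x"] distrib_left mult_ac)
  ultimately have "M ** mlog M = c *\<^sub>R M + log_slope 1 ((1 - g^2) * a * b) *\<^sub>R (M ** M)"
    using diagonalizes_affine[OF V diagonalizes_mult[OF V V]]
    by (intro diagonalizes_unique[of V]) (simp_all only:)
  then show ?thesis by (rule that)
qed

text \<open>Entrywise conjugation without transposing: the change of basis on \<open>B\<close> that
  must accompany \<open>U\<close> on \<open>A\<close> to fix \<open>|00> + |11>\<close>.\<close>

definition cnj_matrix :: "complex^'n^'m \<Rightarrow> complex^'n^'m"
  where "cnj_matrix A = (\<chi> i j. cnj (A $ i $ j))"

lemma cnj_matrix_mult: "cnj_matrix (A ** B) = cnj_matrix A ** cnj_matrix B"
  by (simp add: cnj_matrix_def matrix_matrix_mult_def vec_eq_iff)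

lemma cnj_matrix_mat_1 [simp]: "cnj_matrix (mat 1) = mat 1"
  by (simp add: cnj_matrix_def mat_def vec_eq_iff)

lemma conj_transpose_cnj_matrix: "conj_transpose (cnj_matrix A) = cnj_matrix (conj_transpose A)"
  by (simp add: cnj_matrix_def conj_transpose_def vec_eq_iff)

lemma unitary_cnj_matrix: "unitary U \<Longrightarrow> unitary (cnj_matrix U)"
  by (simp add: unitary_def conj_transpose_cnj_matrix flip: cnj_matrix_mult)

text \<open>Here \<open>blk (sym2 1 1 1) 0 0\<close> is the projection onto \<open>|00> + |11>\<close>, a vector that does not
  depend on the basis.\<close>

lemma tensor_cnj_blk_invariant:
  fixes U :: "complex^2^2"
  assumes "unitary U"
  shows "tensor U (cnj_matrix U) ** blk (sym2 1 1 1) 0 0 ** conj_transpose (tensor U (cnj_matrix U))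
     = blk (sym2 1 1 1) 0 0" (is "?L = _")
proof -
  have "?L $ (i, j) $ (k, l) = (U ** conj_transpose U) $ i $ j * cnj ((U ** conj_transpose U) $ k $ l)"
    for i j k l
    by (simp add: matrix_matrix_mult_def sum_2 sum_2_2 tensor_def conj_transpose_def cnj_matrix_def
        blk_def algebra_simps)
  then show ?thesis
    using assms by (simp add: unitary_def vec_eq_iff forall_2 blk_def mat_def)
qed

lemma hermitian_mpowr: "diagonalizes U d \<rho> \<Longrightarrow> conj_transpose (mpowr \<rho> s) = mpowr \<rho> s"
  using diagonalizes_hermitian[OF diagonalizes_mpowr] by (simp add: hermitian_def)

lemma powr_A_cancel:
  assumes "diagonalizes U d \<rho>" "\<And>i. 0 < d i"
  shows "powr_A \<rho> (1/2) ** powr_A \<rho> (-1/2) = mat 1"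
    and "powr_A \<rho> (-1/2) ** powr_A \<rho> (1/2) = mat 1"
    and "powr_A \<rho> (1/2) ** powr_A \<rho> (1/2) = tensor \<rho> (mat 1)"
  using mpowr_mult[OF assms, of "1/2" "-1/2"] mpowr_mult[OF assms, of "-1/2" "1/2"]
    mpowr_mult[OF assms, of "1/2" "1/2"]
  by (simp_all add: powr_A_def tensor_mult mpowr_0[OF assms] mpowr_1[OF assms])

text \<open>Multiplying \<open>M ** mlog M\<close> by \<open>\<rho>^(-1/2)\<close> on both sides
  gives the operator under the trace, so it equals
  \<open>c \<Gamma> + G \<Gamma> \<rho> \<Gamma>\<close>. The first term drops out because the
  diagonal of \<open>X\<close> is antisymmetric, and the second sees only the diagonal of
  \<rho>.\<close>

lemma trace_mlog_dephasing:
  fixes \<rho> X :: "complex^2^2"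
  assumes dg: "diagonalizes U d \<rho>" "\<And>i. 0 < d i"
    and \<rho>: "\<rho> $ 1 $ 1 = of_real a" "\<rho> $ 2 $ 2 = of_real b"
    and ab: "0 < a" "0 < b" "a + b = 1"
    and g: "g = 2 * q - 1" "g \<noteq> 0" "g^2 < 1"
    and X: "X $ 1 $ 1 = of_real C" "X $ 2 $ 2 = - of_real C"
  shows "trace (tensor X (mat 1) ** choi (dephasing q) ** powr_A \<rho> (1/2)
           ** mlog (sandwich (dephasing q) \<rho>) ** powr_A \<rho> (-1/2))
         = of_real (log_slope 1 ((1 - g^2) * a * b) * ((1 - g^2) * (a - b) * C))"
proof -
  let ?G = "log_slope 1 ((1 - g^2) * a * b)"
  define S where "S = mpowr \<rho> (1/2)"
  define T :: "complex^(2\<times>2)^(2\<times>2)" where "T = powr_A \<rho> (1/2)"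
  define Ti :: "complex^(2\<times>2)^(2\<times>2)" where "Ti = powr_A \<rho> (-1/2)"
  define \<Gamma> where "\<Gamma> = blk (sym2 1 1 g) 0 0"
  have T: "T ** Ti = mat 1" "Ti ** T = mat 1" "T ** T = tensor \<rho> (mat 1)"
    unfolding T_def Ti_def by (rule powr_A_cancel[OF dg])+
  have \<Gamma>: "choi (dephasing q) = \<Gamma>" by (simp add: choi_dephasing \<Gamma>_def g(1))
  define M where "M = T ** \<Gamma> ** T"
  have S: "conj_transpose S = S" unfolding S_def by (rule hermitian_mpowr[OF dg(1)])
  have "conj_transpose S ** S = \<rho>"
    using mpowr_mult[OF dg, of "1/2" "1/2"] S by (simp add: S_def mpowr_1[OF dg])
  \<comment> \<open>The squared column norms of the square root of \<rho> are the diagonal entries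
    of \<rho>.\<close>
  then have "(conj_transpose S ** S) $ i $ i = \<rho> $ i $ i" for i by simp
  from this[of 1] this[of 2]
  have "complex_of_real (cmod (S $ 1 $ 1) ^ 2 + cmod (S $ 2 $ 1) ^ 2) = of_real a"
    "complex_of_real (cmod (S $ 1 $ 2) ^ 2 + cmod (S $ 2 $ 2) ^ 2) = of_real b"
    unfolding of_real_add complex_norm_square
    by (simp_all add: \<rho> matrix_matrix_mult_def conj_transpose_def sum_2 mult.commute)
  then have norms: "cmod (S $ 1 $ 1) ^ 2 + cmod (S $ 2 $ 1) ^ 2 = a"
    "cmod (S $ 1 $ 2) ^ 2 + cmod (S $ 2 $ 2) ^ 2 = b"
    using of_real_eq_iff by blast+
  have "M = tensor S (mat 1) ** blk (sym2 1 1 g) 0 0 ** conj_transpose (tensor S (mat 1))"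
    by (simp add: M_def T_def \<Gamma>_def powr_A_def conj_transpose_tensor S S_def[symmetric])
  then obtain c where c: "M ** mlog M = c *\<^sub>R M + ?G *\<^sub>R (M ** M)"
    using mult_mlog_sandwich_blk[OF norms ab g(2,3)] by blast
  have "Ti ** (M ** mlog M) ** Ti = c *\<^sub>R (Ti ** M ** Ti) + ?G *\<^sub>R (Ti ** (M ** M) ** Ti)"
    by (simp only: c matrix_add_ldistrib matrix_add_rdistrib scaleR_matrix_mult)
  also have "Ti ** (M ** mlog M) ** Ti = \<Gamma> ** T ** mlog M ** Ti"
    by (simp add: M_def matrix_mul_assoc T)
  also have "Ti ** M ** Ti = \<Gamma>"
  proof -
    have "Ti ** M ** Ti = (Ti ** T) ** \<Gamma> ** (T ** Ti)" by (simp add: M_def matrix_mul_assoc)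
    then show ?thesis by (simp add: T)
  qed
  also have "Ti ** (M ** M) ** Ti = \<Gamma> ** tensor \<rho> (mat 1) ** \<Gamma>"
  proof -
    have "Ti ** (M ** M) ** Ti = (Ti ** T) ** \<Gamma> ** (T ** T) ** \<Gamma> ** (T ** Ti)"
      by (simp add: M_def matrix_mul_assoc)
    then show ?thesis by (simp add: T)
  qed
  finally have eq: "tensor X (mat 1) ** \<Gamma> ** T ** mlog M ** Ti =
     c *\<^sub>R (tensor X (mat 1) ** \<Gamma>) + ?G *\<^sub>R (tensor X (mat 1) ** (\<Gamma> ** tensor \<rho> (mat 1) ** \<Gamma>))"
    by (simp add: matrix_mul_assoc[symmetric] matrix_add_ldistrib)
  have tr: "trace (tensor X (mat 1) ** blk m 0 0) = of_real C * (m $ 1 $ 1 - m $ 2 $ 2)" for m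
    by (simp add: trace_mult_blk tensor_nth X mat_def algebra_simps)
  have M: "sandwich (dephasing q) \<rho> = M"
    by (simp add: sandwich_def M_def \<Gamma> T_def)
  have "trace (tensor X (mat 1) ** \<Gamma> ** T ** mlog M ** Ti) =
     ?G *\<^sub>R (of_real C * of_real ((1 - g^2) * (a - b)))"
    unfolding eq trace_add trace_scaleR unfolding \<Gamma>_def blk_tensor_blk tr
    by (simp add: matrix_matrix_mult_def sum_2 \<rho> power2_eq_square algebra_simps)
  then show ?thesis
    unfolding \<Gamma> M T_def Ti_def by (simp add: scaleR_conv_of_real[where 'a=complex] mult_ac)
qed

text \<open>\<open>C\<close> is the Z component of the Bloch vector of the first column of
  \<open>U\<close>. The matrix \<open>Z\<close> is Hermitian with trace 0 and determinant -1, which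
  fixes the moduli of its entries; the diagonal of \<open>X\<close> follows from its trace and its
  trace against \<open>pauli_Z\<close>.\<close>

lemma pauli_Z_conj_entries:
  fixes U :: "complex^2^2"
  assumes U: "unitary U" and X: "X = U ** real_diag (\<lambda>i. if i = 1 then 1 else -1) ** conj_transpose U"
    and Z: "Z = conj_transpose U ** pauli_Z ** U"
  obtains C :: real where "C^2 \<le> 1" "X $ 1 $ 1 = of_real C" "X $ 2 $ 2 = - of_real C"
    "Z $ 1 $ 1 = of_real C" "Z $ 2 $ 2 = - of_real C"
    "Z $ 1 $ 2 * cnj (Z $ 1 $ 2) = 1 - (of_real C)^2" "Z $ 2 $ 1 * cnj (Z $ 2 $ 1) = 1 - (of_real C)^2"
proof -
  have P: "conj_transpose pauli_Z = pauli_Z" "trace pauli_Z = 0" "det pauli_Z = -1"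
    by (simp_all add: pauli_Z_def conj_transpose_def vec_eq_iff forall_2 trace_def sum_2 det_2)
  have "hermitian Z" by (simp add: Z hermitian_def conj_transpose_mult P matrix_mul_assoc)
  note H = hermitian_nth[OF this]
  define C where "C = Re (Z $ 1 $ 1)"
  have Z11: "Z $ 1 $ 1 = of_real C" using H[of 1 1] by (simp add: C_def complex_eq_iff)
  have "trace Z = trace (U ** conj_transpose U ** pauli_Z)"
    unfolding Z by (subst trace_mul_sym) (simp add: matrix_mul_assoc)
  then have "trace Z = 0" using U by (simp add: unitary_def P)
  then have Z22: "Z $ 2 $ 2 = - of_real C" by (simp add: trace_def sum_2 Z11 add_eq_0_iff)
  have "det Z = det (conj_transpose U ** U) * det pauli_Z"
    by (simp add: Z det_mul)
  then have "det Z = -1" using U by (simp add: unitary_def P)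
  then have w: "Z $ 1 $ 2 * Z $ 2 $ 1 = 1 - (of_real C)^2"
    by (simp add: det_2 Z11 Z22 power2_eq_square algebra_simps)
  have Z21: "Z $ 2 $ 1 = cnj (Z $ 1 $ 2)" using H[of 1 2] by simp
  have w1: "Z $ 1 $ 2 * cnj (Z $ 1 $ 2) = 1 - (of_real C)^2" using w Z21 by simp
  have w2: "Z $ 2 $ 1 * cnj (Z $ 2 $ 1) = 1 - (of_real C)^2" using w Z21 by (simp add: mult.commute)
  have "complex_of_real (cmod (Z $ 1 $ 2) ^ 2) = of_real (1 - C^2)"
    using complex_norm_square[of "Z $ 1 $ 2"] w1 by simp
  then have "cmod (Z $ 1 $ 2) ^ 2 = 1 - C^2" using of_real_eq_iff by blast
  then have C: "C^2 \<le> 1" using zero_le_power2[of "cmod (Z $ 1 $ 2)"] by linarith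
  let ?D = "real_diag (\<lambda>i. if i = 1 then 1 else -1) :: complex^2^2"
  have "trace X = trace (conj_transpose U ** (U ** ?D))"
    unfolding X by (subst trace_mul_sym) simp
  also have "\<dots> = trace ?D" using U by (simp add: unitary_cancel)
  finally have t1: "X $ 1 $ 1 + X $ 2 $ 2 = 0" by (simp add: trace_def sum_2 real_diag_def)
  have "trace (pauli_Z ** X) = trace (conj_transpose U ** (pauli_Z ** U ** ?D))"
    unfolding X by (subst trace_mul_sym[of "conj_transpose U"]) (simp add: matrix_mul_assoc)
  also have "\<dots> = trace (Z ** ?D)" by (simp add: Z matrix_mul_assoc)
  finally have t2: "X $ 1 $ 1 - X $ 2 $ 2 = 2 * of_real C"
    by (simp add: trace_def sum_2 matrix_matrix_mult_def real_diag_def pauli_Z_def Z11 Z22)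
  have "X $ 1 $ 1 = of_real C" "X $ 2 $ 2 = - of_real C"
    using t1 t2 by (simp_all add: complex_eq_iff) 
  then show ?thesis using that C Z11 Z22 w1 w2 by blast
qed

text \<open>Conjugation by \<open>V\<close> makes the powers of \<rho> diagonal and leaves the
  depolarizing Choi matrix unchanged, so the logarithm acts on a \<open>blk\<close>. The basis
  dependence moves into the dephasing Choi matrix, where \<open>C\<close> enters.\<close>

lemma trace_mlog_depolarizing:
  fixes \<rho> X :: "complex^2^2"
  assumes dg: "diagonalizes U d \<rho>" "\<And>i. 0 < d i" and d1: "d 1 + d 2 = 1"
    and X: "X = U ** real_diag (\<lambda>i. if i = 1 then 1 else -1) ** conj_transpose U"
    and Z: "Z = conj_transpose U ** pauli_Z ** U"
    and C: "Z $ 1 $ 1 = of_real C" "Z $ 2 $ 2 = - of_real C"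
    "Z $ 1 $ 2 * cnj (Z $ 1 $ 2) = 1 - (of_real C)^2" "Z $ 2 $ 1 * cnj (Z $ 2 $ 1) = 1 - (of_real C)^2"
    and p: "0 < p" "p < 1" and ab: "\<alpha> = 1 - p / 2" "\<beta> = 1 - p"
    and G: "G = log_slope \<alpha> ((\<alpha>^2 - \<beta>^2) * d 1 * d 2)"
  shows "trace (tensor X (mat 1) ** choi (dephasing q) ** powr_A \<rho> (1/2)
           ** mlog (sandwich (depolarizing p) \<rho>) ** powr_A \<rho> (-1/2))
         = of_real ((2 * q - 1) * (\<alpha> - \<beta>) * (d 1 - d 2) * G
            + (1 - q) * ((1 + C^2) * \<alpha> * (d 1 - d 2) * G - (1 - C^2) * \<beta> * (d 1 - d 2) * G
            + (1 - C^2) * (ln (d 1) - ln (d 2))))"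
proof -
  define V where "V = tensor U (cnj_matrix U)"
  define V' where "V' = conj_transpose V"
  have U: "unitary U" using dg(1) by (simp add: diagonalizes_def)
  have V: "unitary V" unfolding V_def by (intro unitary_tensor unitary_cnj_matrix U)
  then have VV: "V' ** V = mat 1" "V ** V' = mat 1" by (simp_all add: V'_def unitary_def)
  have diag: "real_diag e = sym2 (e 1) (e 2) 0" for e
    by (simp add: vec_eq_iff forall_2 real_diag_def)
  have on_A: "tensor (U ** sym2 x y 0 ** conj_transpose U) (mat 1)
      = V ** blk (sym2 x y 0) (of_real x) (of_real y) ** V'" for x y
  proof -
    have "tensor (sym2 x y 0) (mat 1) = blk (sym2 x y 0) (of_real x) (of_real y)"
      using tensor_real_diag_mat_1[of "\<lambda>i. if i = 1 then x else y"] by (simp add: diag)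
    then show ?thesis
      using unitary_cnj_matrix[OF U]
      by (simp add: V'_def V_def conj_transpose_tensor tensor_mult unitary_def
          flip: \<open>tensor _ _ = _\<close>)
  qed
  define s1 s2 where "s1 = sqrt (d 1)" and "s2 = sqrt (d 2)"
  have s: "0 < s1" "0 < s2" "d 1 = s1^2" "d 2 = s2^2" using dg(2)[of 1] dg(2)[of 2] by (simp_all add: s1_def s2_def)
  define Q where "Q = blk (sym2 s1 s2 0) (of_real s1) (of_real s2)"
  define Qi where "Qi = blk (sym2 (1/s1) (1/s2) 0) (of_real (1/s1)) (of_real (1/s2))"
  have T: "powr_A \<rho> (1/2) = V ** Q ** V'"
  proof -
    have "mpowr \<rho> (1/2) = U ** real_diag (\<lambda>i. d i powr (1/2)) ** conj_transpose U"
      using diagonalizes_mpowr[OF dg(1)] by (simp add: diagonalizes_def)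
    moreover have "d i powr (1/2) = sqrt (d i)" for i using dg(2)[of i] by (simp add: powr_half_sqrt)
    ultimately show ?thesis by (simp add: powr_A_def diag on_A Q_def s1_def s2_def)
  qed
  have Ti: "powr_A \<rho> (-1/2) = V ** Qi ** V'"
  proof -
    have "mpowr \<rho> (-1/2) = U ** real_diag (\<lambda>i. d i powr (-1/2)) ** conj_transpose U"
      using diagonalizes_mpowr[OF dg(1), of "-1/2"] by (simp only: diagonalizes_def)
    moreover have "d i powr (-1/2) = 1 / sqrt (d i)" for i
      using dg(2)[of i] powr_minus_divide[of "d i" "1/2"] by (simp add: powr_half_sqrt)
    ultimately show ?thesis by (simp add: powr_A_def diag on_A Qi_def s1_def s2_def)
  qed
  define P where "P = blk (sym2 1 (-1) 0) 1 (-1)"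
  have X': "tensor X (mat 1) = V ** P ** V'"
    using on_A[of 1 "-1"] by (simp add: X diag P_def)
  define \<Phi> where "\<Phi> = blk (sym2 1 1 1) 0 0"
  have \<Phi>: "V ** \<Phi> ** V' = \<Phi>"
    unfolding V_def V'_def \<Phi>_def by (rule tensor_cnj_blk_invariant[OF U])
  then have \<Phi>': "V' ** \<Phi> ** V = \<Phi>"
    using unitary_cancel[OF V] VV by (metis V'_def matrix_mul_assoc matrix_mul_rid)
  define \<Gamma>2 where "\<Gamma>2 = blk (sym2 \<alpha> \<alpha> \<beta>) (of_real (\<alpha> - \<beta>)) (of_real (\<alpha> - \<beta>))"
  have \<Gamma>2: "choi (depolarizing p) = \<Gamma>2" by (simp add: choi_depolarizing \<Gamma>2_def ab field_simps)
  \<comment> \<open>A combination of \<Phi> and the identity is invariant under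
    \<open>V\<close>.\<close>
  have "\<Gamma>2 = \<beta> *\<^sub>R \<Phi> + (\<alpha> - \<beta>) *\<^sub>R mat 1"
    unfolding \<Gamma>2_def \<Phi>_def blk_mat_1[symmetric] blk_scaleR blk_add
    by (simp add: vec_eq_iff forall_2 blk_def mat_def scaleR_conv_of_real[where 'a=complex])
  then have \<Gamma>2V: "V' ** \<Gamma>2 ** V = \<Gamma>2"
    by (simp add: matrix_add_ldistrib matrix_add_rdistrib \<Phi>' VV)
  let ?m = "sym2 (\<alpha> * d 1) (\<alpha> * d 2) (\<beta> * (s1 * s2))"
  have "sandwich (depolarizing p) \<rho> = V ** (Q ** (V' ** \<Gamma>2 ** V) ** Q) ** V'"
    by (simp only: sandwich_def T \<Gamma>2 matrix_mul_assoc)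
  also have "Q ** (V' ** \<Gamma>2 ** V) ** Q = blk ?m (of_real ((\<alpha> - \<beta>) * d 1)) (of_real ((\<alpha> - \<beta>) * d 2))"
    unfolding \<Gamma>2V unfolding \<Gamma>2_def Q_def blk_mult s
    by (simp add: vec_eq_iff forall_2 blk_def matrix_matrix_mult_def sum_2 power2_eq_square mult_ac)
  finally have M: "sandwich (depolarizing p) \<rho> = V ** \<dots> ** V'" .
  have \<alpha>\<beta>: "0 < \<beta>" "\<beta> < \<alpha>" using p ab by auto
  have tm: "\<alpha> * d 1 + \<alpha> * d 2 = \<alpha>" using d1 by (simp flip: distrib_left)
  have dm: "\<alpha> * d 1 * (\<alpha> * d 2) - (\<beta> * (s1 * s2))^2 = (\<alpha>^2 - \<beta>^2) * d 1 * d 2"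
    unfolding s by (simp add: power2_eq_square algebra_simps)
  have \<alpha>\<beta>2: "\<beta>^2 < \<alpha>^2" using \<alpha>\<beta> by (simp add: power_strict_mono)
  then have dpos: "0 < (\<alpha>^2 - \<beta>^2) * d 1 * d 2" using dg(2) by simp
  have dlt: "4 * ((\<alpha>^2 - \<beta>^2) * d 1 * d 2) < \<alpha>^2"
  proof -
    have "4 * (d 1 * d 2) = (d 1 + d 2)^2 - (d 1 - d 2)^2" by (simp add: power2_eq_square algebra_simps)
    then have "4 * (d 1 * d 2) \<le> 1" using zero_le_power2[of "d 1 - d 2"] by (simp add: d1)
    then have "(\<alpha>^2 - \<beta>^2) * (4 * (d 1 * d 2)) \<le> (\<alpha>^2 - \<beta>^2) * 1"
      using \<alpha>\<beta>2 by (intro mult_left_mono) auto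
    also have "\<dots> < \<alpha>^2" using \<alpha>\<beta> by simp
    finally show ?thesis by (simp add: mult_ac)
  qed
  obtain R e c where R: "diagonalizes R e ?m" "\<And>i. 0 < e i" "\<And>i. ln (e i) = c + G * e i"
  proof (rule sym2_diagonalizes_ln[of "\<alpha> * d 1" "\<alpha> * d 2" "\<beta> * (s1 * s2)"])
    show "0 < \<alpha> * d 1 + \<alpha> * d 2" unfolding tm using \<alpha>\<beta> by simp
    show "(\<beta> * (s1 * s2))^2 < \<alpha> * d 1 * (\<alpha> * d 2)" using dm dpos by linarith
    show "4 * (\<alpha> * d 1 * (\<alpha> * d 2) - (\<beta> * (s1 * s2))^2) < (\<alpha> * d 1 + \<alpha> * d 2)^2"
      unfolding tm dm by (rule dlt)
  qed (use that in \<open>simp add: tm dm G\<close>)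
  let ?f = "\<lambda>x. if 0 < x then ln x else 0"
  have f: "herm_fun ?f ?m = c *\<^sub>R mat 1 + G *\<^sub>R ?m"
    using R by (intro herm_fun_affine) auto
  define L where "L = blk (c *\<^sub>R mat 1 + G *\<^sub>R ?m) (of_real (ln ((\<alpha> - \<beta>) * d 1))) (of_real (ln ((\<alpha> - \<beta>) * d 2)))"
  have L: "mlog (sandwich (depolarizing p) \<rho>) = V ** L ** V'"
    unfolding mlog_def M V'_def herm_fun_conj[OF diagonalizes_blk[OF R(1)] V]
      herm_fun_blk[OF R(1)] f L_def using \<alpha>\<beta> dg(2) by simp
  define \<Gamma> where "\<Gamma> = blk (sym2 1 1 (2 * q - 1)) 0 0"
  \<comment> \<open>In this decomposition only the Pauli term changes under \<open>V\<close>, and it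
    becomes \<open>tensor Z (cnj_matrix Z)\<close>.\<close>
  have \<Gamma>: "\<Gamma> = (2 * q - 1) *\<^sub>R \<Phi> + (1 - q) *\<^sub>R (mat 1 + tensor pauli_Z (cnj_matrix pauli_Z))"
    by (simp add: vec_eq_iff forall_2 \<Gamma>_def \<Phi>_def blk_def mat_def tensor_def pauli_Z_def cnj_matrix_def
        scaleR_conv_of_real[where 'a=complex])
  define Y where "Y = (2 * q - 1) *\<^sub>R \<Phi> + (1 - q) *\<^sub>R (mat 1 + tensor Z (cnj_matrix Z))"
  have "V' ** tensor pauli_Z (cnj_matrix pauli_Z) ** V = tensor Z (cnj_matrix Z)"
    by (simp add: V'_def V_def conj_transpose_tensor tensor_mult Z cnj_matrix_mult conj_transpose_cnj_matrix)
  then have Y: "V' ** \<Gamma> ** V = Y"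
    by (simp add: \<Gamma> Y_def matrix_add_ldistrib matrix_add_rdistrib \<Phi>' VV)
  define m where "m = sym2 s1 s2 0 ** (c *\<^sub>R mat 1 + G *\<^sub>R ?m) ** sym2 (1/s1) (1/s2) 0 ** sym2 1 (-1) 0"
  have K: "Q ** L ** Qi ** P = blk m (of_real (ln ((\<alpha> - \<beta>) * d 1))) (- of_real (ln ((\<alpha> - \<beta>) * d 2)))"
    using s(1,2) by (simp add: Q_def L_def Qi_def P_def blk_mult m_def)
  have m: "m $ 1 $ 1 = of_real (c + G * (\<alpha> * d 1))" "m $ 2 $ 2 = - of_real (c + G * (\<alpha> * d 2))"
    "m $ 1 $ 2 = - of_real (G * \<beta> * d 1)" "m $ 2 $ 1 = of_real (G * \<beta> * d 2)"
    using s(1,2) by (simp_all add: m_def matrix_matrix_mult_def sum_2 mat_def s(3,4) power2_eq_square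
        scaleR_conv_of_real[where 'a=complex])
  have "trace (tensor X (mat 1) ** \<Gamma> ** (V ** Q ** V') ** (V ** L ** V') ** (V ** Qi ** V'))
      = trace (V ** (P ** V' ** \<Gamma> ** (V ** Q ** V') ** (V ** L ** V') ** (V ** Qi ** V')))"
    by (simp only: X' matrix_mul_assoc)
  also have "\<dots> = trace (P ** (V' ** \<Gamma> ** V) ** (Q ** (V' ** V) ** L ** (V' ** V) ** Qi ** (V' ** V)))"
    by (subst trace_mul_sym) (simp only: matrix_mul_assoc)
  also have "\<dots> = trace (P ** (Y ** (Q ** L ** Qi)))"
    by (simp add: VV Y matrix_mul_assoc)
  also have "\<dots> = trace (Y ** (Q ** L ** Qi ** P))"
    by (subst trace_mul_sym) (simp only: matrix_mul_assoc)
  also have "\<dots> = of_real ((2 * q - 1) * (\<alpha> - \<beta>) * (d 1 - d 2) * G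
            + (1 - q) * ((1 + C^2) * \<alpha> * (d 1 - d 2) * G - (1 - C^2) * \<beta> * (d 1 - d 2) * G
            + (1 - C^2) * (ln (d 1) - ln (d 2))))"
  proof -
    \<comment> \<open>The constants \<open>ln (\<alpha> - \<beta>)\<close> and \<open>c\<close>
      cancel: they enter with opposite signs from \<open>P\<close>, against equal diagonal entries
      of \<open>Y\<close>.\<close>
    have l: "ln ((\<alpha> - \<beta>) * d i) = ln (\<alpha> - \<beta>) + ln (d i)" for i
      using \<alpha>\<beta> dg(2)[of i] by (simp add: ln_mult)
    show ?thesis
      unfolding K trace_mult_blk m l
      by (simp add: Y_def \<Phi>_def blk_def mat_def tensor_nth cnj_matrix_def C
          scaleR_conv_of_real[where 'a=complex])
        (simp add: algebra_simps power2_eq_square)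
  qed
  finally show ?thesis
    unfolding T Ti L choi_dephasing \<Gamma>_def .
qed

subsection \<open>Fixed points\<close>

text \<open>After rescaling to trace 1, the determinants are compared factor by factor:
  \<open>4 d1 d2 = 1 - r^2\<close> is at most \<open>4 a b = 1 - r^2 C^2\<close> with
  \<open>r = d1 - d2\<close>, and the assumption on \<open>g\<close> compares the prefactors. The
  smaller determinant has the larger slope.\<close>

lemma log_slope_comparison:
  fixes C d1 d2 \<alpha> \<beta> g :: real
  assumes d: "0 < d1" "0 < d2" "d1 + d2 = 1" and C: "C^2 \<le> 1"
    and \<alpha>\<beta>: "0 < \<beta>" "\<beta> < \<alpha>" and g: "g \<noteq> 0" "\<alpha>^2 - \<beta>^2 \<le> \<alpha>^2 * (1 - g^2)"
    and ab: "a = (1 + (d1 - d2) * C) / 2" "b = (1 - (d1 - d2) * C) / 2"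
  shows "log_slope 1 ((1 - g^2) * a * b) \<le> \<alpha> * log_slope \<alpha> ((\<alpha>^2 - \<beta>^2) * d1 * d2)"
proof -
  have "\<beta>^2 < \<alpha>^2" using \<alpha>\<beta> by (simp add: power_strict_mono)
  then have \<alpha>: "0 < (\<alpha>^2 - \<beta>^2) / \<alpha>^2" using \<alpha>\<beta> by simp
  have \<alpha>g: "(\<alpha>^2 - \<beta>^2) / \<alpha>^2 \<le> 1 - g^2" using g(2) \<alpha>\<beta> by (simp add: field_simps)
  have "4 * ((1 + z) / 2 * ((1 - z) / 2)) = 1 - z^2" for z :: real
    by (simp add: power2_eq_square field_simps)
  then have ab4: "4 * (a * b) = 1 - (d1 - d2)^2 * C^2"
    unfolding ab power_mult_distrib[symmetric] .
  have "4 * (d1 * d2) = (d1 + d2)^2 - (d1 - d2)^2" by (simp add: power2_eq_square algebra_simps)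
  moreover have "(d1 - d2)^2 * C^2 \<le> (d1 - d2)^2" using C by (simp add: mult_left_le)
  ultimately have le: "d1 * d2 \<le> a * b" using d(3) ab4 by simp
  have pos: "0 < d1 * d2" using d by simp
  have D: "0 < (\<alpha>^2 - \<beta>^2) * d1 * d2 / \<alpha>^2" using mult_pos_pos[OF \<alpha> pos] by (simp add: mult_ac)
  have "(\<alpha>^2 - \<beta>^2) / \<alpha>^2 * (d1 * d2) \<le> (1 - g^2) * (a * b)"
    using \<alpha> \<alpha>g pos by (intro mult_mono[OF \<alpha>g le]) linarith+
  then have D': "(\<alpha>^2 - \<beta>^2) * d1 * d2 / \<alpha>^2 \<le> (1 - g^2) * a * b" by (simp add: mult_ac)
  have "(1 - g^2) * (a * b) < 1 * (a * b)"
    using g(1) le pos by (intro mult_strict_right_mono) auto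
  moreover have "4 * (a * b) \<le> 1" unfolding ab4 by simp
  ultimately have "(1 - g^2) * (a * b) < 1 / 4" by linarith
  then have "(1 - g^2) * a * b < 1 / 4" by (simp only: mult.assoc)
  from log_slope_1_mono[OF D D' this] show ?thesis
    using \<alpha>\<beta> log_slope_scale[of \<alpha> "(\<alpha>^2 - \<beta>^2) * d1 * d2"] by (simp add: mult_ac)
qed

text \<open>\<open>X\<close> is the traceless operator with the eigenvectors of \<open>\<rho>\<close>, so \<open>\<rho> = I/2 + (d\<^sub>1 - d\<^sub>2)/2 X\<close>.
  The sign statement says that \<open>Tr ((\<rho> - I/2) \<Omega>) > 0\<close> unless \<open>\<rho> = I/2\<close>.\<close>

lemma trace_mult_Omega_sign:
  fixes \<rho> X :: "complex^2^2"
  assumes dg: "diagonalizes U d \<rho>" "\<And>i. 0 < d i" and d1: "d 1 + d 2 = 1"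
    and X: "X = U ** real_diag (\<lambda>i. if i = 1 then 1 else -1) ** conj_transpose U"
  obtains F where "trace (X ** Omega (dephasing (2/5)) (depolarizing (1/20)) \<rho>) = of_real F"
    "d 1 \<noteq> d 2 \<Longrightarrow> 0 < (d 1 - d 2) * F" "d 1 = d 2 \<Longrightarrow> F = 0"
proof -
  define r where "r = d 1 - d 2"
  have U: "unitary U" using dg(1) by (simp add: diagonalizes_def)
  define Z where "Z = conj_transpose U ** pauli_Z ** U"
  obtain C :: real where C: "C^2 \<le> 1" "X $ 1 $ 1 = of_real C" "X $ 2 $ 2 = - of_real C"
    "Z $ 1 $ 1 = of_real C" "Z $ 2 $ 2 = - of_real C"
    "Z $ 1 $ 2 * cnj (Z $ 1 $ 2) = 1 - (of_real C)^2" "Z $ 2 $ 1 * cnj (Z $ 2 $ 1) = 1 - (of_real C)^2"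
    using pauli_Z_conj_entries[OF U X Z_def] by blast
  have dX: "diagonalizes U (\<lambda>i. if i = 1 then 1 else -1) X" using U X by (simp add: diagonalizes_def)
  have "\<rho> = (1/2) *\<^sub>R mat 1 + (r/2) *\<^sub>R X"
  proof (rule diagonalizes_unique[OF dg(1)])
    have "d i = 1/2 * 1 + r/2 * (if i = 1 then 1 else -1)" for i
      using exhaust_2[of i] d1 by (auto simp: r_def field_simps)
    then show "diagonalizes U d ((1/2) *\<^sub>R mat 1 + (r/2) *\<^sub>R X)"
      using diagonalizes_affine[OF diagonalizes_mat_1[OF U] dX, of "1/2" "r/2"]
      by (metis (no_types, lifting) ext)
  qed
  then have \<rho>: "\<rho> $ 1 $ 1 = of_real ((1 + r * C) / 2)" "\<rho> $ 2 $ 2 = of_real ((1 - r * C) / 2)"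
    using C(2,3) by (simp_all add: mat_def scaleR_conv_of_real[where 'a=complex] field_simps)
  have "\<bar>r\<bar> < 1" using dg(2)[of 1] dg(2)[of 2] d1 by (auto simp: r_def)
  moreover have "\<bar>C\<bar> \<le> 1" using C(1) by (simp add: abs_square_le_1)
  ultimately have "\<bar>r * C\<bar> < 1"
    using mult_left_le[of "\<bar>C\<bar>" "\<bar>r\<bar>"] by (simp add: abs_mult)
  then have ab: "0 < (1 + r * C) / 2" "0 < (1 - r * C) / 2" "(1 + r * C) / 2 + (1 - r * C) / 2 = 1"
    by (auto simp: field_simps)
  define G where "G = log_slope (39/40) (((39/40)^2 - (19/20)^2) * d 1 * d 2)"
  define G1 where "G1 = log_slope 1 ((1 - (-1/5)^2) * ((1 + r * C) / 2) * ((1 - r * C) / 2))"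
  \<comment> \<open>With \<open>\<alpha> = 39/40\<close>, \<open>\<beta> = 19/20\<close> and
    \<open>q = 2/5\<close>, the coefficient of \<open>r G\<close> is
    \<open>-1/200 + 3/5 (1/40 + 77/40 C^2)\<close>, and \<open>24/25 = 1 - (1/5)^2\<close>.\<close>
  define F where "F = r * ((1/100 + 231/200 * C^2) * G - 24/25 * C^2 * G1)
     + 3/5 * (1 - C^2) * (ln (d 1) - ln (d 2))"
  have "trace (X ** Omega1 (dephasing (2/5)) (depolarizing (1/20)) \<rho>)
      = trace (tensor X (mat 1) ** choi (dephasing (2/5)) ** powr_A \<rho> (1/2)
           ** mlog (sandwich (depolarizing (1/20)) \<rho>) ** powr_A \<rho> (-1/2))
       - trace (tensor X (mat 1) ** choi (dephasing (2/5)) ** powr_A \<rho> (1/2)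
           ** mlog (sandwich (dephasing (2/5)) \<rho>) ** powr_A \<rho> (-1/2))"
    by (simp only: trace_mult_Omega1 matrix_diff_ldistrib matrix_diff_rdistrib trace_sub minus_diff_eq)
  also have "\<dots> = of_real F"
  proof -
    have l: "trace (tensor X (mat 1) ** choi (dephasing (2/5)) ** powr_A \<rho> (1/2)
           ** mlog (sandwich (dephasing (2/5)) \<rho>) ** powr_A \<rho> (-1/2))
         = of_real (G1 * ((1 - (-1/5)^2) * ((1 + r * C) / 2 - (1 - r * C) / 2) * C))"
      unfolding G1_def by (rule trace_mlog_dephasing[OF dg \<rho> ab _ _ _ C(2,3)]) (auto simp: power2_eq_square)
    have m: "trace (tensor X (mat 1) ** choi (dephasing (2/5)) ** powr_A \<rho> (1/2)
           ** mlog (sandwich (depolarizing (1/20)) \<rho>) ** powr_A \<rho> (-1/2))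
         = of_real ((2 * (2/5) - 1) * (39/40 - 19/20) * (d 1 - d 2) * G
            + (1 - 2/5) * ((1 + C^2) * (39/40) * (d 1 - d 2) * G - (1 - C^2) * (19/20) * (d 1 - d 2) * G
            + (1 - C^2) * (ln (d 1) - ln (d 2))))"
      by (rule trace_mlog_depolarizing[OF dg d1 X Z_def C(4-7)]) (auto simp: G_def)
    show ?thesis
      unfolding l m of_real_diff[symmetric] of_real_eq_iff F_def r_def[symmetric]
      by (simp add: power2_eq_square field_simps)
  qed
  finally have "trace (X ** Omega (dephasing (2/5)) (depolarizing (1/20)) \<rho>) = of_real F"
    by (simp add: trace_mult_Omega[OF diagonalizes_hermitian[OF dX]])
  moreover have "0 < r * F" if "r \<noteq> 0"
  proof -
    have "4 * (d 1 * d 2) = (d 1 + d 2)^2 - (d 1 - d 2)^2" by (simp add: power2_eq_square algebra_simps)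
    then have "4 * (d 1 * d 2) \<le> 1" by (simp add: d1)
    then have G: "0 < G" unfolding G_def
      using dg(2) by (intro log_slope_pos) (auto simp: power2_eq_square mult.assoc)
    have "G1 \<le> 39/40 * G" unfolding G1_def G_def
      by (rule log_slope_comparison[OF dg(2) dg(2) d1 C(1)]) (auto simp: r_def power2_eq_square)
    then have "C^2 * G1 \<le> C^2 * (39/40 * G)"
      by (rule mult_left_mono) simp
    then have "C^2 * G1 \<le> 39/40 * (C^2 * G)" by simp
    moreover have "0 \<le> C^2 * G" using G by simp
    moreover have "(1/100 + 231/200 * C^2) * G - 24/25 * C^2 * G1
        = 1/100 * G + 231/200 * (C^2 * G) - 24/25 * (C^2 * G1)"
      by (simp add: distrib_right)
    \<comment> \<open>As \<open>24/25 * 39/40 = 0.936\<close> is below \<open>231/200\<close>, the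
      \<open>C^2\<close> terms are nonnegative in total; \<open>1/100 * G\<close> makes the sum
      strictly positive even for \<open>C = 0\<close>.\<close>
    ultimately have "0 < (1/100 + 231/200 * C^2) * G - 24/25 * C^2 * G1"
      using G by linarith
    then have "0 < r^2 * ((1/100 + 231/200 * C^2) * G - 24/25 * C^2 * G1)"
      using that by simp
    \<comment> \<open>\<open>ln\<close> is increasing, so both factors have the same sign.\<close>
    moreover have "0 \<le> r * (ln (d 1) - ln (d 2))"
      using dg(2)[of 1] dg(2)[of 2] by (cases "d 1 \<le> d 2") (auto simp: r_def intro: mult_nonpos_nonpos)
    then have "0 \<le> 3/5 * (1 - C^2) * (r * (ln (d 1) - ln (d 2)))"
      using C(1) by simp
    moreover have "r * F = r^2 * ((1/100 + 231/200 * C^2) * G - 24/25 * C^2 * G1)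
        + 3/5 * (1 - C^2) * (r * (ln (d 1) - ln (d 2)))"
      by (simp add: F_def power2_eq_square algebra_simps)
    ultimately show ?thesis by linarith
  qed
  moreover have "F = 0" if "d 1 = d 2" using that by (simp add: F_def r_def)
  ultimately show ?thesis using that unfolding r_def by auto
qed

section \<open>The maximally mixed state\<close>

lemma positive_definite_half: "positive_definite ((1/2) *\<^sub>R mat 1 :: complex^'n^'n)"
  unfolding positive_definite_def
proof (intro conjI allI impI)
  show "hermitian ((1/2) *\<^sub>R mat 1 :: complex^'n^'n)"
    by (simp add: hermitian_def conj_transpose_scaleR)
  fix x :: "complex^'n" assume "x \<noteq> 0"
  have half: "((1/2) *\<^sub>R mat 1 *v x) $ i = x $ i / 2" for i
    by (simp add: matrix_vector_mult_def mat_def scaleR_conv_of_real[where 'a=complex]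
        if_distrib[of "\<lambda>y. _ * y"] if_distrib[of "\<lambda>y. y * _"] cong: if_cong)
  then have "quadratic_form ((1/2) *\<^sub>R mat 1) x = (\<Sum>i\<in>UNIV. (cmod (x $ i))^2 / 2)"
    unfolding quadratic_form_def cmod_power2 half by (simp add: power2_eq_square add_divide_distrib)
  moreover obtain i where "x $ i \<noteq> 0" using \<open>x \<noteq> 0\<close> by (auto simp: vec_eq_iff)
  then have "0 < (\<Sum>i\<in>UNIV. (cmod (x $ i))^2 / 2)" by (intro sum_pos2[of _ i]) auto
  ultimately show "0 < quadratic_form ((1/2) *\<^sub>R mat 1) x" by simp
qed

lemma density_operator_half: "density_operator ((1/2) *\<^sub>R mat 1 :: complex^2^2)"
proof -
  have "0 \<le> quadratic_form A x" if "positive_definite A" for A :: "complex^2^2" and x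
    using that by (cases "x = 0") (auto simp: positive_definite_def quadratic_form_def less_imp_le)
  with positive_definite_half show ?thesis
    by (auto simp: density_operator_def positive_semidefinite_def positive_definite_def trace_def sum_2
        mat_def scaleR_conv_of_real[where 'a=complex])
qed

text \<open>A scalar shift of the exponent only rescales the exponential, and normalization removes
  it.\<close>

lemma AB_map_half:
  fixes N1 N2 :: "complex^2^2 \<Rightarrow> complex^'b^'b"
  assumes "Omega N1 N2 ((1/2) *\<^sub>R mat 1) = k *\<^sub>R mat 1"
  shows "AB_map \<gamma> N1 N2 ((1/2) *\<^sub>R mat 1) = (1/2) *\<^sub>R mat 1"
proof -
  define h where "h = ln (1/2) - 1/\<gamma> * k"
  have "mlog ((1/2) *\<^sub>R mat 1 :: complex^2^2) = ln (1/2) *\<^sub>R mat 1"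
    by (simp add: mlog_def herm_fun_scaleR_mat_1)
  then have "mlog ((1/2) *\<^sub>R mat 1) - (1/\<gamma>) *\<^sub>R Omega N1 N2 ((1/2) *\<^sub>R mat 1) = h *\<^sub>R mat 1"
    by (simp add: assms h_def scaleR_diff_left)
  then have "AB_map \<gamma> N1 N2 ((1/2) *\<^sub>R mat 1) = normalize_trace (exp h *\<^sub>R mat 1)"
    by (simp add: AB_map_def mexp_def herm_fun_scaleR_mat_1)
  then show ?thesis
    by (simp add: normalize_trace_def vec_eq_iff forall_2 mat_def trace_def sum_2 scaleR_conv_of_real[where 'a=complex])
qed

text \<open>Taking \<open>U\<close> to be an eigenbasis of \<Omega> itself makes the trace against
  \<open>X\<close> equal to \<open>e 1 - e 2\<close>. The state is diagonal in this basis with equal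
  eigenvalues, so the trace is 0.\<close>

lemma Omega_half:
  obtains k where "Omega (dephasing (2/5)) (depolarizing (1/20)) ((1/2) *\<^sub>R mat 1) = k *\<^sub>R mat 1"
proof -
  let ?O = "Omega (dephasing (2/5)) (depolarizing (1/20)) ((1/2) *\<^sub>R mat 1)"
  obtain U e where O: "diagonalizes U e ?O"
    using hermitian_2_diagonalizes[OF hermitian_Omega] .
  then have U: "unitary U" by (simp add: diagonalizes_def)
  define X where "X = U ** real_diag (\<lambda>i. if i = 1 then 1 else -1) ** conj_transpose U"
  have dX: "diagonalizes U (\<lambda>i. if i = 1 then 1 else -1) X" using U X_def by (simp add: diagonalizes_def)
  have "diagonalizes U (\<lambda>_. 1/2) ((1/2) *\<^sub>R mat 1)"
    using diagonalizes_affine[OF diagonalizes_mat_1[OF U] diagonalizes_mat_1[OF U], of "1/2" 0] by simp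
  then have "trace (X ** ?O) = 0"
    using trace_mult_Omega_sign[OF _ _ _ X_def] by (metis add.commute field_sum_of_halves half_gt_zero_iff of_real_0 zero_less_one)
  then have "complex_of_real (e 1 - e 2) = of_real 0"
    using trace_diagonalizes[OF diagonalizes_mult[OF dX O]] by (simp add: sum_2)
  then have "e 1 = e 2" unfolding of_real_eq_iff by simp
  then have "e i = e 1 * 1 + 0 * 1" for i using exhaust_2[of i] by auto
  then have "diagonalizes U e (e 1 *\<^sub>R mat 1)"
    using diagonalizes_affine[OF diagonalizes_mat_1[OF U] diagonalizes_mat_1[OF U], of "e 1" 0]
    by (simp add: fun_eq_iff) (metis ext)
  then have "?O = e 1 *\<^sub>R mat 1" by (rule diagonalizes_unique[OF O])
  then show ?thesis by (rule that)
qed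

theorem theorem17:
  fixes p q \<gamma> :: real
    and N1 N2 :: "complex^2^2 \<Rightarrow> complex^2^2"
  assumes "p = 0.05" and "q = 0.4"
    and "N1 = dephasing q" and "N2 = depolarizing p"
    and "\<gamma> > 0"
  shows "(\<forall>\<rho>. density_operator \<rho> \<and> positive_definite \<rho> \<longrightarrow>
            complex_of_real (objective N1 N2 \<rho>) = trace (\<rho> ** Omega N1 N2 \<rho>)) \<and>
         {\<rho>. density_operator \<rho> \<and> positive_definite \<rho> \<and> AB_map \<gamma> N1 N2 \<rho> = \<rho>}
            = {(1/2) *\<^sub>R mat 1}"
proof -
  have diag: "\<exists>U d. diagonalizes U d \<rho> \<and> (\<forall>i. 0 < d i)" if "positive_definite \<rho>" for \<rho> :: "complex^2^2"
    using that hermitian_2_diagonalizes[of \<rho>] diagonalizes_positive[of _ _ \<rho>]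
    by (metis positive_definite_def)
  have N: "N1 = dephasing (2/5)" "N2 = depolarizing (1/20)" using assms(3,4) unfolding assms(1,2) by simp_all
  have uniq: "\<rho> = (1/2) *\<^sub>R mat 1"
    if \<rho>: "density_operator \<rho>" "positive_definite \<rho>" "AB_map \<gamma> N1 N2 \<rho> = \<rho>" for \<rho>
  proof -
    obtain U d where dg: "diagonalizes U d \<rho>" "\<And>i. 0 < d i" using diag \<rho>(2) by blast
    then have U: "unitary U" by (simp add: diagonalizes_def)
    have "complex_of_real (d 1 + d 2) = of_real 1"
      using trace_diagonalizes[OF dg(1)] \<rho>(1) by (simp add: density_operator_def sum_2)
    then have d1: "d 1 + d 2 = 1" unfolding of_real_eq_iff .
    define X where "X = U ** real_diag (\<lambda>i. if i = 1 then 1 else -1) ** conj_transpose U"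
    have "diagonalizes U (\<lambda>i. if i = 1 then 1 else -1) X" using U X_def by (simp add: diagonalizes_def)
    then have X0: "trace X = 0" by (simp add: trace_diagonalizes sum_2)
    obtain k where "Omega N1 N2 \<rho> = k *\<^sub>R mat 1"
      using AB_map_fixed_point_Omega[OF dg(1) \<rho>(3)] assms(5) by auto
    \<comment> \<open>The traceless \<open>X\<close> annihilates a scalar \<Omega>, whereas unequal
      eigenvalues of \<rho> would force a nonzero trace.\<close>
    then have "trace (X ** Omega N1 N2 \<rho>) = 0" by (simp add: trace_scaleR X0)
    then have "d 1 = d 2"
      using trace_mult_Omega_sign[OF dg d1 X_def] unfolding N by (metis less_irrefl mult_zero_right of_real_eq_0_iff)
    then have "d i = 1/2 * 1 + 0 * 1" for i using exhaust_2[of i] d1 by auto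
    then have "d = (\<lambda>i. 1/2 * 1 + 0 * 1)" by (rule ext)
    then show ?thesis
      using diagonalizes_unique[OF dg(1)]
        diagonalizes_affine[OF diagonalizes_mat_1[OF U] diagonalizes_mat_1[OF U], of "1/2" 0] by simp
  qed
  obtain k where "Omega N1 N2 ((1/2) *\<^sub>R mat 1) = k *\<^sub>R mat 1"
    using Omega_half unfolding N by blast
  note fixed = AB_map_half[OF this, of \<gamma>]
  show ?thesis
    using diag objective_eq_trace uniq fixed positive_definite_half density_operator_half by blast
qed

end
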